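(* Let $C$ be a depth-$2$ $\mathrm{AC}^0[\oplus]$ circuit on $n$ inputs, of size $n^c$, which computes an affine disperser for dimension $k$. Then $k>k_2(\sqrt{n}/5,\,2c)=\Omega(n^{1/(4c)})$.
   Context: An $\mathrm{AC}^0[\oplus]$ circuit is a circuit whose inputs are literals $x_i,\neg x_i$ and whose gates are unbounded fan-in AND, OR and XOR gates; its size is the number of gates. A function $f\colon\mathbb{F}_2^n\to\mathbb{F}_2$ is an affine disperser for dimension $k$ if it is non-constant on every affine subspace of $\mathbb{F}_2^n$ of dimension $k$. For integers $m,D$, $k_2(m,D)$ denotes the largest integer $k$ such that every polynomial over $\mathbb{F}_2$ on $m$ variables of degree at most $D$ is constant on some affine subspace of $\mathbb{F}_2^m$ of dimension $k$.
   Formalization: The bound Ω(n^{1/(4c)}) is claimed only for c ≥ 1/2: for 0 < c < 1/2, degree at most 2c means constant polynomials, so k_2 is at most √n/5, which grows more slowly than n^{1/(4c)}; k > k_2 is proved for all c > 0, with √n/5 and 2c rounded down. *)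

theory Defs
  imports
    "HOL-Analysis.Analysis"
    "HOL-Library.Z2"
    "HOL-Library.Function_Algebras"
    "HOL-Library.Poly_Mapping"
    "HOL-Library.Landau_Symbols"
begin

text \<open>
  The dimension \<open>n\<close> varies inside the statements, so \<open>F_2^n\<close> is the set \<open>F2_space n\<close> of all
  functions \<open>nat \<Rightarrow> bit\<close> vanishing outside the coordinates \<open>0, \<dots>, n - 1\<close>; it is a subspace of
  the \<open>F_2\<close>-vector space of all functions \<open>nat \<Rightarrow> bit\<close> with pointwise operations.
\<close>

definition F2_scale :: "bit \<Rightarrow> (nat \<Rightarrow> bit) \<Rightarrow> (nat \<Rightarrow> bit)" where
  "F2_scale c x = (\<lambda>i. c * x i)"

global_interpretation F2: vector_space F2_scale
  by unfold_locales (auto simp: F2_scale_def fun_eq_iff algebra_simps)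

definition F2_space :: "nat \<Rightarrow> (nat \<Rightarrow> bit) set" where
  "F2_space n = {x. \<forall>i\<ge>n. x i = 0}"

definition affine_subspace :: "nat \<Rightarrow> nat \<Rightarrow> (nat \<Rightarrow> bit) set \<Rightarrow> bool" where
  "affine_subspace n k A \<longleftrightarrow>
     (\<exists>a\<in>F2_space n. \<exists>W. F2.subspace W \<and> W \<subseteq> F2_space n \<and> F2.dim W = k \<and> A = (\<lambda>w. a + w) ` W)"

definition affine_disperser :: "nat \<Rightarrow> nat \<Rightarrow> ((nat \<Rightarrow> bit) \<Rightarrow> bit) \<Rightarrow> bool" where
  "affine_disperser n k f \<longleftrightarrow> (\<forall>A. affine_subspace n k A \<longrightarrow> \<not> f constant_on A)"


type_synonym F2_poly = "(nat \<Rightarrow>\<^sub>0 nat) \<Rightarrow>\<^sub>0 bit"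

text \<open>A key of an \<open>F2_poly\<close> is a monomial, given by its exponent vector.\<close>

definition poly_vars :: "F2_poly \<Rightarrow> nat set" where
  "poly_vars p = (\<Union>e\<in>Poly_Mapping.keys p. Poly_Mapping.keys e)"

definition mono_degree :: "(nat \<Rightarrow>\<^sub>0 nat) \<Rightarrow> nat" where
  "mono_degree e = (\<Sum>i\<in>Poly_Mapping.keys e. Poly_Mapping.lookup e i)"

definition poly_degree_le :: "F2_poly \<Rightarrow> nat \<Rightarrow> bool" where
  "poly_degree_le p D \<longleftrightarrow> (\<forall>e\<in>Poly_Mapping.keys p. mono_degree e \<le> D)"

definition poly_eval :: "F2_poly \<Rightarrow> (nat \<Rightarrow> bit) \<Rightarrow> bit" where
  "poly_eval p x =
     (\<Sum>e\<in>Poly_Mapping.keys p. Poly_Mapping.lookup p e *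
        (\<Prod>i\<in>Poly_Mapping.keys e. x i ^ Poly_Mapping.lookup e i))"

definition k2_admissible :: "nat \<Rightarrow> nat \<Rightarrow> nat \<Rightarrow> bool" where
  "k2_admissible m D k \<longleftrightarrow>
     (\<forall>p. poly_vars p \<subseteq> {..<m} \<and> poly_degree_le p D \<longrightarrow>
        (\<exists>A. affine_subspace m k A \<and> poly_eval p constant_on A))"

definition k2 :: "nat \<Rightarrow> nat \<Rightarrow> nat" where
  "k2 m D = Max {k. k2_admissible m D k}"

text \<open>The maximum above ranges over a finite nonempty set.\<close>

lemma F2_span_units: "F2_space m \<subseteq> F2.span ((\<lambda>i j. of_bool (i = j)) ` {..<m})"
proof
  fix x assume x: "x \<in> F2_space m"
  have "(\<Sum>i<m. F2_scale (x i) (\<lambda>j. of_bool (i = j))) j = x j" for j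
  proof -
    have "(\<Sum>i<m. F2_scale (x i) (\<lambda>j. of_bool (i = j))) j
        = (\<Sum>i<m. F2_scale (x i) (\<lambda>j. of_bool (i = j)) j)"
      by (induction m) auto
    also have "\<dots> = (\<Sum>i<m. if i = j then x i else 0)"
      by (intro sum.cong) (auto simp: F2_scale_def)
    also have "\<dots> = x j"
      using x by (auto simp: F2_space_def)
    finally show ?thesis .
  qed
  then have "x = (\<Sum>i<m. F2_scale (x i) (\<lambda>j. of_bool (i = j)))"
    by (intro ext) simp
  also have "\<dots> \<in> F2.span ((\<lambda>i j. of_bool (i = j)) ` {..<m})"
    by (intro F2.span_sum F2.span_scale F2.span_base) auto
  finally show "x \<in> F2.span ((\<lambda>i j. of_bool (i = j)) ` {..<m})" .
qed

lemma affine_subspace_dim_le: "affine_subspace m k A \<Longrightarrow> k \<le> m"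
proof -
  assume "affine_subspace m k A"
  then obtain W where W: "W \<subseteq> F2_space m" "F2.dim W = k"
    by (auto simp: affine_subspace_def)
  let ?B = "(\<lambda>i j. of_bool (i = j)) ` {..<m} :: (nat \<Rightarrow> bit) set"
  have "F2.dim W \<le> card ?B"
    using W F2_span_units[of m] by (intro F2.dim_le_card) auto
  also have "\<dots> \<le> m"
    using card_image_le[of "{..<m}"] by fastforce
  finally show "k \<le> m" using W by simp
qed

lemma k2_admissible_le: "k2_admissible m D k \<Longrightarrow> k \<le> m"
  unfolding k2_admissible_def
  by (auto dest!: spec[of _ 0] affine_subspace_dim_le simp: poly_vars_def poly_degree_le_def)

lemma finite_k2_admissible: "finite {k. k2_admissible m D k}"
  by (rule finite_subset[of _ "{..m}"]) (auto dest: k2_admissible_le)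

lemma k2_admissible_0: "k2_admissible m D 0"
proof -
  have dim: "F2.dim {0} = 0"
    using F2.dim_le_card[of "{0}" "{}"] by simp
  have "affine_subspace m 0 {0}"
    unfolding affine_subspace_def
    by (rule bexI[of _ 0], rule exI[of _ "{0}"]) (auto simp: dim F2_space_def F2.subspace_single_0)
  then show ?thesis
    by (auto simp: k2_admissible_def constant_on_def intro!: exI[of _ "{0}"])
qed


datatype gate_kind = AND | OR | XOR

datatype circuit = Pos nat | Neg nat | Gate gate_kind "circuit list"

fun gate_fun :: "gate_kind \<Rightarrow> bit list \<Rightarrow> bit" where
  "gate_fun AND bs = of_bool (\<forall>b\<in>set bs. b = 1)"
| "gate_fun OR bs = of_bool (\<exists>b\<in>set bs. b = 1)"
| "gate_fun XOR bs = sum_list bs"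

primrec circuit_eval :: "circuit \<Rightarrow> (nat \<Rightarrow> bit) \<Rightarrow> bit" where
  "circuit_eval (Pos i) = (\<lambda>x. x i)"
| "circuit_eval (Neg i) = (\<lambda>x. 1 + x i)"
| "circuit_eval (Gate g cs) = (\<lambda>x. gate_fun g (map (\<lambda>h. h x) (map circuit_eval cs)))"

primrec circuit_vars :: "circuit \<Rightarrow> nat set" where
  "circuit_vars (Pos i) = {i}"
| "circuit_vars (Neg i) = {i}"
| "circuit_vars (Gate g cs) = \<Union> (set (map circuit_vars cs))"

primrec circuit_depth :: "circuit \<Rightarrow> nat" where
  "circuit_depth (Pos i) = 0"
| "circuit_depth (Neg i) = 0"
| "circuit_depth (Gate g cs) = Suc (Max (insert 0 (set (map circuit_depth cs))))"

primrec circuit_gates :: "circuit \<Rightarrow> circuit set" where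
  "circuit_gates (Pos i) = {}"
| "circuit_gates (Neg i) = {}"
| "circuit_gates (Gate g cs) = insert (Gate g cs) (\<Union> (set (map circuit_gates cs)))"

text \<open>
  Circuits are acyclic graphs, in which the output of a gate may be used several times. A term of
  type \<open>circuit\<close> stands for the graph obtained by identifying equal subterms, so the size counts
  \<^emph>\<open>distinct\<close> gates. Unfolding an arbitrary circuit graph gives a term that computes the same
  function, with the same depth and at most as many distinct gates.
\<close>

definition circuit_size :: "circuit \<Rightarrow> nat" where
  "circuit_size C = card (circuit_gates C)"

definition computes :: "nat \<Rightarrow> circuit \<Rightarrow> ((nat \<Rightarrow> bit) \<Rightarrow> bit) \<Rightarrow> bool" where
  "computes n C f \<longleftrightarrow> circuit_vars C \<subseteq> {..<n} \<and> (\<forall>x\<in>F2_space n. circuit_eval C x = f x)"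

end

theory Submission
  imports Defs
begin

text \<open>
  Write \<open>m = \<surd>n / 5\<close> and \<open>D = 2c\<close>. Suppose the top gate is XOR. Split the variables into \<open>m\<close> blocks
  of more than \<open>2\<surd>n\<close> variables; in each block keep one variable alive and fix the others. Averaged over
  these choices, the weight \<open>z ^ (number of live literals)\<close>, with \<open>z\<close> half the block size and weight
  \<open>0\<close> for falsified conjunctions, does not increase from block to block, because \<open>1 + w \<le> 2 ^ w\<close>. As
  \<open>n ^ c < z ^ (D + 1)\<close>, some restriction leaves every conjunction falsified or of width at most \<open>D\<close>, so
  the circuit becomes a polynomial of degree at most \<open>D\<close> in \<open>m\<close> variables.

  If the top gate is AND (dually, OR), it suffices to falsify one bottom gate on a large subspace. This
  fails only when all nontrivial bottom gates are disjunctions of more than \<open>n - m\<close> literals; if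
  \<open>D < m\<close> these are so few that a single assignment of \<open>n - m\<close> variables satisfies all of them, and if
  \<open>D \<ge> m\<close> every function of \<open>m\<close> variables is a polynomial of degree at most \<open>D\<close>.

  For the lower bound on \<open>k2\<close>, a subspace on which \<open>f\<close> is constant is enlarged one vector at a time.
  Since \<open>f\<close> has degree at most \<open>D\<close>, constancy only has to be imposed at sums of at most \<open>D\<close> basis
  vectors. These are few equations of low degree in the new vector, so by Chevalley--Warning they have a
  nonzero solution.
\<close>

section \<open>Affine subspaces of \<open>F_2^n\<close>\<close>

declare add_bit_eq_xor [simp del] mult_bit_eq_and [simp del]

lemma bit_add_self [simp]: "b + b = (0::bit)"
  by (cases b) simp_all

lemma bit_add_cancel [simp]: "b + (b + c) = (c::bit)"
  by (simp flip: add.assoc)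

lemma bit_add_eq_0_iff: "a + b = 0 \<longleftrightarrow> a = (b::bit)"
  by (cases a; cases b) simp_all

lemma F2_add_cancel [simp]: "x + (x + y) = (y :: nat \<Rightarrow> bit)"
  by (simp add: fun_eq_iff)

lemma F2_add_self [simp]: "x + x = (0 :: nat \<Rightarrow> bit)"
  by (simp add: fun_eq_iff)

lemma F2_minus [simp]: "x - y = (x + y :: nat \<Rightarrow> bit)"
  by (simp add: fun_eq_iff)

lemma F2_scale_0 [simp]: "F2_scale 0 x = 0" and F2_scale_1 [simp]: "F2_scale 1 x = x"
  by (simp_all add: F2_scale_def fun_eq_iff)

lemma F2_subspace_iff: "F2.subspace W \<longleftrightarrow> 0 \<in> W \<and> (\<forall>x\<in>W. \<forall>y\<in>W. x + y \<in> W)"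
proof -
  have "F2_scale c x \<in> W" if "0 \<in> W" "x \<in> W" for c x
    using that by (cases c) simp_all
  then show ?thesis
    by (auto simp: F2.subspace_def)
qed

lemma F2_space_add: "x \<in> F2_space n \<Longrightarrow> y \<in> F2_space n \<Longrightarrow> x + y \<in> F2_space n"
  by (simp add: F2_space_def)

lemma F2_space_0: "0 \<in> F2_space n"
  by (simp add: F2_space_def)

lemma card_F2_coords:
  assumes "finite U"
  shows "finite {w :: nat \<Rightarrow> bit. \<forall>i. i \<notin> U \<longrightarrow> w i = 0}"
    and "card {w :: nat \<Rightarrow> bit. \<forall>i. i \<notin> U \<longrightarrow> w i = 0} = 2 ^ card U"
proof -
  have bij: "bij_betw (\<lambda>S i. of_bool (i \<in> S) :: bit) (Pow U) {w. \<forall>i. i \<notin> U \<longrightarrow> w i = 0}"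
    by (rule bij_betw_byWitness[where f' = "\<lambda>w. {i. w i = 1}"]) (auto simp: fun_eq_iff)
  show "finite {w :: nat \<Rightarrow> bit. \<forall>i. i \<notin> U \<longrightarrow> w i = 0}"
    using bij_betw_finite[OF bij] assms by simp
  show "card {w :: nat \<Rightarrow> bit. \<forall>i. i \<notin> U \<longrightarrow> w i = 0} = 2 ^ card U"
    using bij_betw_same_card[OF bij] assms by (simp add: card_Pow)
qed

lemma F2_space_coords: "F2_space n = {w. \<forall>i. i \<notin> {..<n} \<longrightarrow> w i = 0}"
  by (auto simp: F2_space_def)

lemma finite_F2_space: "finite (F2_space n)" and card_F2_space: "card (F2_space n) = 2 ^ n"
  unfolding F2_space_coords by (simp_all only: card_F2_coords finite_lessThan card_lessThan)

text \<open>Adding an independent vector \<open>b\<close> splits the new span into the old span and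
  its disjoint coset by \<open>b\<close>, so the size doubles.\<close>

lemma card_F2_span:
  "finite B \<Longrightarrow> F2.independent B \<Longrightarrow> finite (F2.span B) \<and> card (F2.span B) = 2 ^ card B"
proof (induction B rule: finite_induct)
  case (insert b B)
  have ind: "F2.independent B" and b: "b \<notin> F2.span B"
    using insert F2.independent_insert[of b B] by auto
  note IH = insert.IH[OF ind]
  have "F2.span (insert b B) = F2.span B \<union> (+) b ` F2.span B" (is "?L = ?R")
  proof (intro equalityI subsetI)
    fix x assume "x \<in> ?L"
    then obtain k where k: "x - F2_scale k b \<in> F2.span B"
      by (auto simp: F2.span_insert)
    show "x \<in> ?R"
    proof (cases "k = 0")
      case True
      then show ?thesis using k by simp
    next
      case False
      then have "x + b \<in> F2.span B" using k by simp
      then have "b + (x + b) \<in> (+) b ` F2.span B" by (rule imageI)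
      then show ?thesis by (simp add: add.commute[of x])
    qed
  next
    have sub: "F2.span B \<subseteq> F2.span (insert b B)"
      by (intro F2.span_mono) auto
    fix x assume "x \<in> ?R"
    then show "x \<in> ?L"
      using sub F2.span_base[of b "insert b B"] by (auto intro: F2.span_add)
  qed
  moreover have "F2.span B \<inter> (+) b ` F2.span B = {}"
  proof -
    have False if "s \<in> F2.span B" "b + s \<in> F2.span B" for s
      using F2.span_add[OF that(2) that(1)] b by (simp add: add.assoc)
    then show ?thesis by auto
  qed
  moreover have "card ((+) b ` F2.span B) = card (F2.span B)"
    by (intro card_image) simp
  ultimately show ?case
    using IH insert.hyps by (simp add: card_Un_disjoint)
qed auto

lemma card_F2_subspace:
  assumes "F2.subspace W" "finite W"
  shows "card W = 2 ^ F2.dim W"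
proof -
  obtain B where B: "B \<subseteq> W" "F2.independent B" "W \<subseteq> F2.span B" "card B = F2.dim W"
    using F2.basis_exists by blast
  then have "F2.span B = W"
    using assms by (intro F2.span_subspace)
  then show ?thesis
    using card_F2_span[of B] B assms finite_subset by metis
qed

text \<open>Over F_2, closure under addition together with 0 already gives a subspace, and a finite
  subspace has dimension \<open>k\<close> exactly when it has 2^k elements. Later constructions
  therefore count elements instead of exhibiting bases.\<close>

lemma affine_subspace_card_iff:
  "affine_subspace n k A \<longleftrightarrow>
     (\<exists>a\<in>F2_space n. \<exists>W. 0 \<in> W \<and> (\<forall>x\<in>W. \<forall>y\<in>W. x + y \<in> W) \<and> W \<subseteq> F2_space n \<and> card W = 2 ^ k \<and>
        A = (+) a ` W)"
proof -
  have dim: "card W = 2 ^ F2.dim W"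
    if "0 \<in> W" "\<forall>x\<in>W. \<forall>y\<in>W. x + y \<in> W" "W \<subseteq> F2_space n" for W
    using card_F2_subspace finite_subset[OF that(3) finite_F2_space] that by (simp add: F2_subspace_iff)
  show ?thesis
    unfolding affine_subspace_def
    by (rule bex_cong[OF refl], rule ex_cong1) (auto simp: dim F2_subspace_iff)
qed

lemma affine_subspace_subset: "affine_subspace n k A \<Longrightarrow> A \<subseteq> F2_space n"
  by (auto simp: affine_subspace_card_iff intro!: F2_space_add)

lemma affine_subspace_mono:
  assumes "affine_subspace n K A" "k \<le> K"
  obtains A' where "A' \<subseteq> A" "affine_subspace n k A'"
proof -
  obtain a W where W: "a \<in> F2_space n" "F2.subspace W" "W \<subseteq> F2_space n" "F2.dim W = K" "A = (+) a ` W"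
    using assms(1) unfolding affine_subspace_def by blast
  obtain B where B: "B \<subseteq> W" "F2.independent B" "W \<subseteq> F2.span B" "card B = F2.dim W"
    using F2.basis_exists by blast
  obtain B' where B': "B' \<subseteq> B" "card B' = k"
    using assms(2) B(4) W(4) obtain_subset_with_card_n by metis
  have sub: "F2.span B' \<subseteq> W"
    using B B' W by (intro F2.span_minimal) auto
  have "F2.dim (F2.span B') = k"
    using B B' F2.independent_mono F2.dim_span_eq_card_independent by metis
  then have "affine_subspace n k ((+) a ` F2.span B')"
    using W sub F2.subspace_span unfolding affine_subspace_def by blast
  then show ?thesis
    using that sub W by blast
qed

lemma affine_subspace_enlarge_space:
  assumes "affine_subspace m k A" "m \<le> n"
  shows "affine_subspace n k A"
proof -
  have "F2_space m \<subseteq> F2_space n"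
    using assms(2) by (auto simp: F2_space_def)
  then show ?thesis
    using assms(1) unfolding affine_subspace_def by blast
qed

text \<open>An injective additive map preserves the number of directions. Injectivity is asked only
  on \<open>F2_space m\<close>, because the map used later ignores all coordinates from
  \<open>m\<close> on.\<close>

lemma affine_subspace_image:
  assumes "affine_subspace m k A" and s: "s \<in> F2_space n" and L: "L ` F2_space m \<subseteq> F2_space n"
    and add: "\<And>x y. L (x + y) = L x + L y" and inj: "inj_on L (F2_space m)"
  shows "affine_subspace n k ((\<lambda>y. s + L y) ` A)"
proof -
  obtain a W where W: "a \<in> F2_space m" "0 \<in> W" "\<forall>x\<in>W. \<forall>y\<in>W. x + y \<in> W" "W \<subseteq> F2_space m"
      "card W = 2 ^ k" "A = (+) a ` W"
    using assms(1) unfolding affine_subspace_card_iff by blast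
  have L0: "L 0 = 0"
    using add[of 0 0] by simp
  have "card (L ` W) = 2 ^ k"
    using W inj inj_on_subset card_image by metis
  moreover have "(\<lambda>y. s + L y) ` A = (+) (s + L a) ` L ` W"
    by (simp add: W image_image add add.assoc)
  moreover have "\<forall>x\<in>L ` W. \<forall>y\<in>L ` W. x + y \<in> L ` W"
    using W by (auto simp flip: add)
  moreover have "s + L a \<in> F2_space n"
    using s L W by (intro F2_space_add) auto
  moreover have "0 \<in> L ` W"
    using L0 W by (metis imageI)
  moreover have "L ` W \<subseteq> F2_space n"
    using L W(4) by blast
  ultimately show ?thesis
    unfolding affine_subspace_card_iff by (intro bexI[of _ "s + L a"] exI[of _ "L ` W"] conjI)
qed

lemma affine_subspace_coords:
  assumes "U \<subseteq> {..<n}" "a \<in> F2_space n"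
  shows "affine_subspace n (card U) {x. \<forall>i. i \<notin> U \<longrightarrow> x i = a i}"
proof -
  let ?W = "{w :: nat \<Rightarrow> bit. \<forall>i. i \<notin> U \<longrightarrow> w i = 0}"
  have fin: "finite U"
    using assms finite_subset by blast
  have "{x. \<forall>i. i \<notin> U \<longrightarrow> x i = a i} = (+) a ` ?W"
  proof (intro equalityI subsetI)
    fix x assume "x \<in> {x. \<forall>i. i \<notin> U \<longrightarrow> x i = a i}"
    then have "a + (a + x) \<in> (+) a ` ?W"
      by (intro imageI) auto
    then show "x \<in> (+) a ` ?W" by simp
  qed auto
  moreover have "?W \<subseteq> F2_space n"
    using assms by (auto simp: F2_space_def)
  moreover have "0 \<in> ?W" "\<forall>x\<in>?W. \<forall>y\<in>?W. x + y \<in> ?W"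
    by auto
  ultimately show ?thesis
    unfolding affine_subspace_card_iff using assms card_F2_coords(2)[OF fin]
    by (intro bexI[of _ a] exI[of _ ?W] conjI)
qed

section \<open>Functions of low degree\<close>

text \<open>Degree is treated as a property of functions. Bits are idempotent, so sums of
  multilinear monomials suffice, and rule induction adds one monomial at a time.\<close>

inductive lowdeg :: "nat set \<Rightarrow> nat \<Rightarrow> ((nat \<Rightarrow> bit) \<Rightarrow> bit) \<Rightarrow> bool" for V D where
  lowdeg_0: "lowdeg V D (\<lambda>x. 0)"
| lowdeg_add_mono: "finite A \<Longrightarrow> A \<subseteq> V \<Longrightarrow> card A \<le> D \<Longrightarrow> lowdeg V D f \<Longrightarrow> lowdeg V D (\<lambda>x. (\<Prod>i\<in>A. x i) + f x)"

lemma lowdeg_mono: "lowdeg V D f \<Longrightarrow> V \<subseteq> V' \<Longrightarrow> D \<le> D' \<Longrightarrow> lowdeg V' D' f"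
  by (induction rule: lowdeg.induct) (blast intro: lowdeg_0, rule lowdeg_add_mono, auto)

lemma lowdeg_monomial: "finite A \<Longrightarrow> A \<subseteq> V \<Longrightarrow> card A \<le> D \<Longrightarrow> lowdeg V D (\<lambda>x. \<Prod>i\<in>A. x i)"
  using lowdeg_add_mono[OF _ _ _ lowdeg_0] by simp

lemma lowdeg_var: "i \<in> V \<Longrightarrow> 1 \<le> D \<Longrightarrow> lowdeg V D (\<lambda>x. x i)"
  using lowdeg_monomial[of "{i}"] by simp

lemma lowdeg_const: "lowdeg V D (\<lambda>x. c)"
  using lowdeg_monomial[of "{}"] lowdeg_0 by (cases "c = 0") simp_all

lemma lowdeg_add: "lowdeg V D f \<Longrightarrow> lowdeg V D g \<Longrightarrow> lowdeg V D (\<lambda>x. f x + g x)"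
  by (induction rule: lowdeg.induct) (auto intro: lowdeg.intros simp: add.assoc)

lemma lowdeg_sum: "(\<And>i. i \<in> I \<Longrightarrow> lowdeg V D (f i)) \<Longrightarrow> lowdeg V D (\<lambda>x. \<Sum>i\<in>I. f i x)"
  by (induction I rule: infinite_finite_induct) (auto intro: lowdeg_0 lowdeg_add)

lemma lowdeg_sum_list: "(\<And>h. h \<in> set hs \<Longrightarrow> lowdeg V D (f h)) \<Longrightarrow> lowdeg V D (\<lambda>x. \<Sum>h\<leftarrow>hs. f h x)"
  by (induction hs) (auto intro: lowdeg_0 lowdeg_add)

lemma bit_mult_self [simp]: "b * b = (b::bit)"
  by (cases b) simp_all

lemma prod_bit_union:
  fixes x :: "'a \<Rightarrow> bit"
  assumes "finite A" "finite B"
  shows "(\<Prod>i\<in>A. x i) * (\<Prod>i\<in>B. x i) = (\<Prod>i\<in>A \<union> B. x i)"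
proof -
  have "(\<Prod>i\<in>B. x i) = (\<Prod>i\<in>A \<inter> B. x i) * (\<Prod>i\<in>B - A. x i)"
    using assms by (subst prod.Int_Diff[of B _ A]) (auto simp: Int_commute)
  moreover have "(\<Prod>i\<in>A. x i) = (\<Prod>i\<in>A \<inter> B. x i) * (\<Prod>i\<in>A - B. x i)"
    using assms by (subst prod.Int_Diff[of A _ B]) auto
  moreover have "(\<Prod>i\<in>A \<union> B. x i) = (\<Prod>i\<in>A. x i) * (\<Prod>i\<in>B - A. x i)"
    using assms by (subst prod.union_disjoint[symmetric]) auto
  ultimately show ?thesis
    by (simp add: ac_simps)
qed

text \<open>By idempotence the monomials of \<open>A\<close> and \<open>B\<close> multiply to the
  monomial of their union, whose degree is at most the sum of both.\<close>

lemma lowdeg_mult_monomial: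
  assumes "finite A" "A \<subseteq> V" "lowdeg V E g"
  shows "lowdeg V (card A + E) (\<lambda>x. (\<Prod>i\<in>A. x i) * g x)"
  using assms(3)
proof (induction rule: lowdeg.induct)
  case lowdeg_0
  then show ?case by (simp add: lowdeg.lowdeg_0)
next
  case (lowdeg_add_mono B f)
  have "card (A \<union> B) \<le> card A + E"
    using card_Un_le[of A B] lowdeg_add_mono by simp
  then have "lowdeg V (card A + E) (\<lambda>x. (\<Prod>i\<in>A \<union> B. x i) + (\<Prod>i\<in>A. x i) * f x)"
    using lowdeg_add_mono assms by (intro lowdeg.lowdeg_add_mono) auto
  then show ?case
    using assms lowdeg_add_mono by (simp add: distrib_left prod_bit_union)
qed

lemma lowdeg_mult:
  "lowdeg V D f \<Longrightarrow> lowdeg V E g \<Longrightarrow> lowdeg V (D + E) (\<lambda>x. f x * g x)"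
proof (induction rule: lowdeg.induct)
  case lowdeg_0
  then show ?case by (simp add: lowdeg.lowdeg_0)
next
  case (lowdeg_add_mono A f)
  have "lowdeg V (D + E) (\<lambda>x. (\<Prod>i\<in>A. x i) * g x)"
    using lowdeg_add_mono by (intro lowdeg_mono[OF lowdeg_mult_monomial[of A V E g]]) auto
  then show ?case
    using lowdeg_add_mono by (simp add: distrib_right lowdeg_add)
qed

lemma lowdeg_prod:
  "finite I \<Longrightarrow> (\<And>i. i \<in> I \<Longrightarrow> lowdeg V (d i) (f i)) \<Longrightarrow> lowdeg V (\<Sum>i\<in>I. d i) (\<lambda>x. \<Prod>i\<in>I. f i x)"
  by (induction I rule: finite_induct) (auto intro: lowdeg_const lowdeg_mult)

lemma lowdeg_translate:
  assumes "lowdeg V D f"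
  shows "lowdeg V D (\<lambda>x. f (a + x))"
  using assms
proof (induction rule: lowdeg.induct)
  case lowdeg_0
  then show ?case by (simp add: lowdeg.lowdeg_0)
next
  case (lowdeg_add_mono A f)
  have "lowdeg V (\<Sum>i\<in>A. 1) (\<lambda>x. \<Prod>i\<in>A. a i + x i)"
    using lowdeg_add_mono by (intro lowdeg_prod lowdeg_add lowdeg_const lowdeg_var) auto
  then have "lowdeg V D (\<lambda>x. \<Prod>i\<in>A. a i + x i)"
    using lowdeg_add_mono by (elim lowdeg_mono) auto
  then show ?case
    using lowdeg_add_mono by (simp add: lowdeg_add)
qed

text \<open>An affine function is additive up to its constant term, which \<open>f x + f y\<close>
  counts twice, that is, not at all; \<open>f 0\<close> restores it.\<close>

lemma lowdeg_affine:
  assumes "lowdeg V 1 f"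
  shows "f (x + y) = f x + f y + f 0"
  using assms
proof (induction rule: lowdeg.induct)
  case (lowdeg_add_mono A f)
  then obtain i where "A = {} \<or> A = {i}"
    by (cases "card A = 0") (auto simp: card_1_singleton_iff le_Suc_eq)
  then show ?case
    using lowdeg_add_mono by (auto simp: ac_simps)
qed simp

text \<open>Interpolation: the indicator of a point \<open>a\<close> is a product of
  \<open>m\<close> affine factors, one per coordinate, each equal to 1 iff \<open>x\<close> and
  \<open>a\<close> agree there.\<close>

lemma lowdeg_universal:
  obtains g where "lowdeg {..<m} m g" "\<And>x. x \<in> F2_space m \<Longrightarrow> g x = f x"
proof
  let ?g = "\<lambda>x. \<Sum>a\<in>F2_space m. f a * (\<Prod>i<m. 1 + a i + x i)"
  have "lowdeg {..<m} (0 + (\<Sum>i<m. 1)) (\<lambda>x. f a * (\<Prod>i<m. 1 + a i + x i))" for a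
    by (intro lowdeg_mult lowdeg_const lowdeg_prod lowdeg_add lowdeg_var) auto
  then show "lowdeg {..<m} m ?g"
    by (intro lowdeg_sum) simp
  fix x assume x: "x \<in> F2_space m"
  have "(\<Prod>i<m. 1 + a i + x i) = of_bool (x = a)" if "a \<in> F2_space m" for a
  proof (cases "x = a")
    case True
    then show ?thesis by (simp add: add.assoc)
  next
    case False
    then obtain i where "x i \<noteq> a i" by (auto simp: fun_eq_iff)
    moreover from this have "i < m"
      using x that by (metis (mono_tags, lifting) F2_space_def mem_Collect_eq not_less)
    ultimately have "\<exists>i\<in>{..<m}. 1 + a i + x i = 0"
      by (intro bexI[of _ i]; cases "x i"; cases "a i") auto
    then show ?thesis using False by (simp add: prod_zero)
  qed
  then have "?g x = (\<Sum>a\<in>F2_space m. f a * of_bool (x = a))"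
    by simp
  also have "\<dots> = (\<Sum>a\<in>F2_space m. if x = a then f a else 0)"
    by (intro sum.cong) auto
  also have "\<dots> = f x"
    using x finite_F2_space by simp
  finally show "?g x = f x" .
qed

section \<open>Formal polynomials and the functions they define\<close>

lemma poly_eval_superset:
  assumes "finite K" "Poly_Mapping.keys p \<subseteq> K"
  shows "poly_eval p x = (\<Sum>e\<in>K. Poly_Mapping.lookup p e *
        (\<Prod>i\<in>Poly_Mapping.keys e. x i ^ Poly_Mapping.lookup e i))"
  unfolding poly_eval_def using assms
  by (intro sum.mono_neutral_left) (auto simp: in_keys_iff)

lemma poly_eval_add: "poly_eval (p + q) x = poly_eval p x + poly_eval q x"
proof -
  let ?K = "Poly_Mapping.keys p \<union> Poly_Mapping.keys q"
  have "Poly_Mapping.keys (p + q) \<subseteq> ?K"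
    by (rule Poly_Mapping.keys_add)
  then show ?thesis
    by (simp add: poly_eval_superset[of ?K] lookup_add distrib_right sum.distrib)
qed

lemma lowdeg_imp_poly:
  assumes "lowdeg V D f"
  obtains p where "poly_vars p \<subseteq> V" "poly_degree_le p D" "poly_eval p = f"
proof -
  have "\<exists>p. poly_vars p \<subseteq> V \<and> poly_degree_le p D \<and> poly_eval p = f"
    using assms
  proof (induction rule: lowdeg.induct)
    case lowdeg_0
    show ?case
      by (rule exI[of _ 0]) (auto simp: poly_vars_def poly_degree_le_def poly_eval_def)
  next
    case (lowdeg_add_mono A f)
    then obtain p where p: "poly_vars p \<subseteq> V" "poly_degree_le p D" "poly_eval p = f"
      by blast
    define e :: "nat \<Rightarrow>\<^sub>0 nat" where "e = Abs_poly_mapping (\<lambda>i. of_bool (i \<in> A))"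
    have lookup: "Poly_Mapping.lookup e i = of_bool (i \<in> A)" for i
      unfolding e_def using lowdeg_add_mono by (subst lookup_Abs_poly_mapping) auto
    have keys: "Poly_Mapping.keys e = A"
      by (auto simp: in_keys_iff lookup)
    define q :: F2_poly where "q = Poly_Mapping.single e 1"
    have "poly_eval q x = (\<Prod>i\<in>A. x i)" for x
      by (simp add: poly_eval_def q_def keys lookup cong: prod.cong del: power_bit_unfold)
    moreover have sub: "Poly_Mapping.keys (q + p) \<subseteq> insert e (Poly_Mapping.keys p)"
      using Poly_Mapping.keys_add[of q p] by (simp add: q_def)
    have "poly_vars (q + p) \<subseteq> A \<union> poly_vars p"
      unfolding poly_vars_def keys[symmetric] using sub by blast
    then have "poly_vars (q + p) \<subseteq> V"
      using p lowdeg_add_mono by blast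
    moreover have "mono_degree e = card A"
      by (simp add: mono_degree_def keys lookup)
    then have "poly_degree_le (q + p) D"
      using p sub lowdeg_add_mono unfolding poly_degree_le_def by auto
    ultimately show ?case
      using p by (intro exI[of _ "q + p"]) (auto simp: poly_eval_add)
  qed
  then show ?thesis using that by blast
qed

lemma poly_imp_lowdeg:
  assumes "poly_vars p \<subseteq> V" "poly_degree_le p D"
  shows "lowdeg V D (poly_eval p)"
proof -
  have "lowdeg V D (\<lambda>x. Poly_Mapping.lookup p e *
        (\<Prod>i\<in>Poly_Mapping.keys e. x i ^ Poly_Mapping.lookup e i))" if "e \<in> Poly_Mapping.keys p" for e
  proof -
    have "card (Poly_Mapping.keys e) \<le> mono_degree e"
      unfolding mono_degree_def card_eq_sum by (intro sum_mono) (auto simp: in_keys_iff)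
    then have "card (Poly_Mapping.keys e) \<le> D"
      using assms that by (fastforce simp: poly_degree_le_def)
    moreover have "Poly_Mapping.keys e \<subseteq> V"
      using assms that by (auto simp: poly_vars_def)
    ultimately have "lowdeg V (0 + D) (\<lambda>x. Poly_Mapping.lookup p e * (\<Prod>i\<in>Poly_Mapping.keys e. x i))"
      by (intro lowdeg_mult lowdeg_const lowdeg_monomial) auto
    \<comment> \<open>Exponents at keys are positive, and every positive power of a bit is the bit
      itself.\<close>
    moreover have "(\<Prod>i\<in>Poly_Mapping.keys e. x i ^ Poly_Mapping.lookup e i) = (\<Prod>i\<in>Poly_Mapping.keys e. x i)" for x :: "nat \<Rightarrow> bit"
      by (rule prod.cong) (auto simp: in_keys_iff)
    ultimately show ?thesis by simp
  qed
  then have "lowdeg V D (\<lambda>x. poly_eval p x)"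
    unfolding poly_eval_def by (intro lowdeg_sum)
  then show ?thesis by simp
qed

section \<open>Sums of low-degree functions over cubes\<close>

lemma sum_Pow_insert:
  assumes "finite S" "i \<notin> S"
  shows "(\<Sum>T\<in>Pow (insert i S). g T) = (\<Sum>T\<in>Pow S. g T) + (\<Sum>T\<in>Pow S. g (insert i T))"
proof -
  have "inj_on (insert i) (Pow S)"
    using assms by (auto simp: inj_on_def)
  moreover have "Pow S \<inter> insert i ` Pow S = {}"
    using assms by auto
  ultimately show ?thesis
    using assms by (simp add: Pow_insert sum.union_disjoint sum.reindex)
qed

text \<open>A derivative in more directions than there are affine factors vanishes. The factor of
  \<open>a\<close> is expanded: its constant part leaves the same sum with one factor fewer, and its
  part at direction \<open>i\<close> forces \<open>i\<close> into \<open>T\<close>, which leaves a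
  sum over the subsets of \<open>S - {i}\<close> with \<open>\<alpha>\<close> shifted by
  \<open>\<beta> i\<close>.\<close>

lemma sum_Pow_prod_affine:
  fixes \<alpha> :: "'a \<Rightarrow> bit"
  assumes "finite A" "finite S" "card A < card S"
  shows "(\<Sum>T\<in>Pow S. \<Prod>j\<in>A. \<alpha> j + (\<Sum>i\<in>T. \<beta> i j)) = 0"
  using assms
proof (induction A arbitrary: S \<alpha> rule: finite_induct)
  case empty
  \<comment> \<open>With no factors the sum counts the subsets of the nonempty set \<open>S\<close>,
    an even number.\<close>
  then show ?case by (simp add: card_Pow of_nat_power zero_power card_gt_0_iff)
next
  case (insert a A)
  let ?P = "\<lambda>T. \<Prod>j\<in>A. \<alpha> j + (\<Sum>i\<in>T. \<beta> i j)"
  have *: "(\<Sum>T\<in>Pow S. of_bool (i \<in> T) * ?P T) = 0" if i: "i \<in> S" for i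
  proof -
    define S' where "S' = S - {i}"
    have S': "S = insert i S'" "i \<notin> S'" "finite S'"
      using i insert.prems by (auto simp: S'_def)
    have "(\<Sum>T\<in>Pow S. of_bool (i \<in> T) * ?P T) = (\<Sum>T\<in>Pow S'. ?P (insert i T))"
      unfolding S'(1) using S' by (subst sum_Pow_insert) (auto intro!: sum.neutral)
    also have "\<dots> = (\<Sum>T\<in>Pow S'. \<Prod>j\<in>A. (\<alpha> j + \<beta> i j) + (\<Sum>i\<in>T. \<beta> i j))"
      using S' by (intro sum.cong prod.cong refl) (subst sum.insert, auto simp: add.assoc intro: finite_subset)
    also have "\<dots> = 0"
      using insert S' by (intro insert.IH) auto
    finally show ?thesis .
  qed
  have split: "(\<Sum>i\<in>T. \<beta> i a) = (\<Sum>i\<in>S. \<beta> i a * of_bool (i \<in> T))" if "T \<in> Pow S" for T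
  proof -
    have "(\<Sum>i\<in>S. \<beta> i a * of_bool (i \<in> T)) = (\<Sum>i\<in>S. if i \<in> T then \<beta> i a else 0)"
      by (intro sum.cong) auto
    also have "\<dots> = (\<Sum>i\<in>S \<inter> T. \<beta> i a)"
      using insert.prems by (simp add: sum.inter_restrict)
    finally show ?thesis
      using that by (simp add: Int_absorb1)
  qed
  have "(\<Sum>T\<in>Pow S. \<Prod>j\<in>insert a A. \<alpha> j + (\<Sum>i\<in>T. \<beta> i j))
      = (\<Sum>T\<in>Pow S. \<alpha> a * ?P T + (\<Sum>i\<in>S. \<beta> i a * (of_bool (i \<in> T) * ?P T)))"
    using insert.hyps by (intro sum.cong refl) (simp add: distrib_right split sum_distrib_right mult.assoc)
  also have "\<dots> = \<alpha> a * (\<Sum>T\<in>Pow S. ?P T) + (\<Sum>i\<in>S. \<beta> i a * (\<Sum>T\<in>Pow S. of_bool (i \<in> T) * ?P T))"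
    by (simp add: sum.distrib sum_distrib_left) (rule sum.swap)
  also have "\<dots> = 0"
    using insert * by simp
  finally show ?case .
qed

lemma sum_cube_lowdeg:
  assumes "lowdeg V D f" "finite S" "D < card S"
  shows "(\<Sum>T\<in>Pow S. f (\<lambda>j. u j + (\<Sum>i\<in>T. v i j))) = 0"
  using assms
  by (induction rule: lowdeg.induct) (auto simp: sum.distrib sum_Pow_prod_affine)

section \<open>Constancy of low-degree functions on large subspaces\<close>

text \<open>Over F_2 a coefficient vector is just a set, so these are the linear combinations of the
  vectors \<open>v i\<close>.\<close>

definition subset_sum :: "(nat \<Rightarrow> nat \<Rightarrow> bit) \<Rightarrow> nat set \<Rightarrow> nat \<Rightarrow> bit" where
  "subset_sum v T = (\<lambda>j. \<Sum>i\<in>T. v i j)"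

lemma subset_sum_empty [simp]: "subset_sum v {} = 0"
  by (simp add: subset_sum_def fun_eq_iff)

lemma subset_sum_insert:
  "finite T \<Longrightarrow> k \<notin> T \<Longrightarrow> subset_sum v (insert k T) = subset_sum v T + v k"
  by (simp add: subset_sum_def fun_eq_iff add.commute)

text \<open>Vectors chosen by both sets cancel, so addition turns into symmetric difference.\<close>

lemma subset_sum_add:
  assumes "finite T" "finite T'"
  shows "subset_sum v T + subset_sum v T' = subset_sum v ((T - T') \<union> (T' - T))"
proof
  fix j
  have "(\<Sum>i\<in>T. v i j) = (\<Sum>i\<in>T \<inter> T'. v i j) + (\<Sum>i\<in>T - T'. v i j)"
    using assms by (intro sum.Int_Diff)
  moreover have "(\<Sum>i\<in>T'. v i j) = (\<Sum>i\<in>T \<inter> T'. v i j) + (\<Sum>i\<in>T' - T. v i j)"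
    using assms by (subst Int_commute) (intro sum.Int_Diff)
  moreover have "(\<Sum>i\<in>(T - T') \<union> (T' - T). v i j) = (\<Sum>i\<in>T - T'. v i j) + (\<Sum>i\<in>T' - T. v i j)"
    using assms by (intro sum.union_disjoint) auto
  ultimately show "(subset_sum v T + subset_sum v T') j = subset_sum v ((T - T') \<union> (T' - T)) j"
    by (simp add: subset_sum_def ac_simps)
qed

lemma subset_sum_in_F2_space:
  "(\<And>i. i \<in> T \<Longrightarrow> v i \<in> F2_space m) \<Longrightarrow> subset_sum v T \<in> F2_space m"
  by (auto simp: subset_sum_def F2_space_def intro!: sum.neutral)

lemma sum_cube_lowdeg':
  assumes "lowdeg V D f" "finite S" "D < card S"
  shows "(\<Sum>T\<in>Pow S. f (u + subset_sum v T)) = 0"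
  using sum_cube_lowdeg[OF assms, of u v] by (simp add: plus_fun_def subset_sum_def)

text \<open>If \<open>card T > D\<close>, the sum of \<open>f + c\<close> over all subsets of
  \<open>T\<close> vanishes. By induction every proper subset contributes 0, hence so does
  \<open>T\<close>.\<close>

lemma lowdeg_const_on_cube:
  assumes f: "lowdeg V D f" and small: "\<And>T. T \<subseteq> S \<Longrightarrow> card T \<le> D \<Longrightarrow> f (u + subset_sum v T) = c"
    and "finite S" "T \<subseteq> S"
  shows "f (u + subset_sum v T) = c"
  using assms(4)
proof (induction "card T" arbitrary: T rule: less_induct)
  case less
  show ?case
  proof (cases "card T \<le> D")
    case False
    have fin: "finite T"
      using less.prems assms finite_subset by blast
    have g: "lowdeg V D (\<lambda>x. f x + c)"
      using f by (intro lowdeg_add lowdeg_const)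
    have "f (u + subset_sum v T') + c = 0" if "T' \<in> Pow T - {T}" for T'
    proof -
      have "card T' < card T"
        using that fin by (intro psubset_card_mono) auto
      then show ?thesis
        using less that by auto
    qed
    moreover have "(\<Sum>T'\<in>Pow T. f (u + subset_sum v T') + c) = 0"
      using sum_cube_lowdeg'[OF g fin] False by simp
    ultimately have "f (u + subset_sum v T) + c = 0"
      using fin by (simp add: sum.remove[of "Pow T" T])
    then show ?thesis
      by (simp add: bit_add_eq_0_iff)
  qed (use small less in auto)
qed

text \<open>The whole space is the cube spanned by the \<open>m\<close> unit vectors.\<close>

lemma sum_F2_space_lowdeg:
  assumes "lowdeg V D f" "D < m"
  shows "(\<Sum>x\<in>F2_space m. f x) = 0"
proof -
  have bij: "bij_betw (\<lambda>T j. of_bool (j \<in> T) :: bit) (Pow {..<m}) (F2_space m)"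
    by (rule bij_betw_byWitness[where f' = "\<lambda>w. {i. w i = 1}"])
      (auto simp: fun_eq_iff F2_space_def intro: ccontr)
  have eq: "(\<lambda>j. of_bool (j \<in> T)) = 0 + subset_sum (\<lambda>i j. of_bool (i = j)) T" if "T \<in> Pow {..<m}" for T
    using that finite_subset[of T "{..<m}"] by (auto simp: fun_eq_iff subset_sum_def of_bool_def)
  have "(\<Sum>x\<in>F2_space m. f x) = (\<Sum>T\<in>Pow {..<m}. f (\<lambda>j. of_bool (j \<in> T)))"
    by (rule sum.reindex_bij_betw[OF bij, symmetric])
  also have "\<dots> = (\<Sum>T\<in>Pow {..<m}. f (0 + subset_sum (\<lambda>i j. of_bool (i = j)) T))"
    using eq by (intro sum.cong refl) metis
  also have "\<dots> = 0"
    using assms by (intro sum_cube_lowdeg') auto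
  finally show ?thesis .
qed

text \<open>Parity form: the values of \<open>h\<close> sum to 0, so 0 cannot be the only point
  where \<open>h\<close> is 1. In the application \<open>h\<close> is the indicator of the solutions
  of a system of equations.\<close>

lemma chevalley_warning:
  assumes h: "lowdeg V D h" "D < m" and "h 0 = 1"
  obtains x where "x \<in> F2_space m" "x \<noteq> 0" "h x = 1"
proof (rule ccontr)
  assume "\<not> thesis"
  then have "h x = 0" if "x \<in> F2_space m - {0}" for x
    using that by (cases "h x = 0") (auto intro: \<open>\<And>x. _ \<Longrightarrow> _ \<Longrightarrow> _ \<Longrightarrow> thesis\<close>)
  then have "(\<Sum>x\<in>F2_space m. h x) = h 0"
    by (simp add: sum.remove[of _ 0] finite_F2_space F2_space_0)
  then show False
    using sum_F2_space_lowdeg[OF h] assms(3) by simp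
qed

text \<open>Each such set is read off a list of length \<open>D\<close>, padded with the dummy entry
  \<open>k\<close>, which lies outside \<open>{..<k}\<close>.\<close>

lemma card_small_subsets: "card {T. T \<subseteq> {..<k} \<and> card T \<le> D} \<le> (k + 1) ^ D"
proof -
  let ?L = "{xs. set xs \<subseteq> {..k} \<and> length xs = D}"
  have "{T. T \<subseteq> {..<k} \<and> card T \<le> D} \<subseteq> (\<lambda>xs. set xs \<inter> {..<k}) ` ?L"
  proof
    fix T assume T: "T \<in> {T. T \<subseteq> {..<k} \<and> card T \<le> D}"
    then obtain xs where xs: "set xs = T" "distinct xs"
      using finite_distinct_list finite_subset by (metis (mono_tags, lifting) finite_lessThan mem_Collect_eq)
    let ?ys = "xs @ replicate (D - card T) k"
    have "?ys \<in> ?L"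
      using T xs by (auto simp: distinct_card[symmetric])
    moreover have "T = set ?ys \<inter> {..<k}"
      using T xs by auto
    ultimately show "T \<in> (\<lambda>xs. set xs \<inter> {..<k}) ` ?L"
      by blast
  qed
  then have "card {T. T \<subseteq> {..<k} \<and> card T \<le> D} \<le> card ?L"
    by (rule surj_card_le[OF finite_lists_length_eq[OF finite_atMost]])
  then show ?thesis
    by (simp add: card_lists_length_eq)
qed

text \<open>\<open>I\<close> is a set of pivot coordinates: a combination that vanishes on
  \<open>I\<close> is empty, which encodes linear independence. A new vector is required to vanish
  on \<open>I\<close>, so it does not disturb the old pivots, and any coordinate where it is 1
  serves as its own pivot.\<close>

lemma exists_independent_cube:
  assumes f: "lowdeg {..<m} D f" and "1 \<le> D" "(D + 1) * k ^ D \<le> m"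
  shows "\<exists>v I. (\<forall>i<k. v i \<in> F2_space m) \<and> finite I \<and> card I \<le> k \<and> I \<subseteq> {..<m} \<and>
           (\<forall>T\<subseteq>{..<k}. (\<forall>i\<in>I. subset_sum v T i = 0) \<longrightarrow> T = {}) \<and>
           (\<forall>T\<subseteq>{..<k}. f (subset_sum v T) = f 0)"
  using assms(3)
proof (induction k)
  case 0
  show ?case by (rule exI, rule exI[of _ "{}"]) auto
next
  case (Suc k)
  have "(D + 1) * k ^ D \<le> (D + 1) * Suc k ^ D"
    by (intro mult_left_mono power_mono) auto
  then have "(D + 1) * k ^ D \<le> m"
    using Suc.prems by (rule order_trans)
  from Suc.IH[OF this] obtain v I where v: "\<And>i. i < k \<Longrightarrow> v i \<in> F2_space m" and I: "finite I" "card I \<le> k" "I \<subseteq> {..<m}"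
    and piv: "\<And>T. T \<subseteq> {..<k} \<Longrightarrow> (\<forall>i\<in>I. subset_sum v T i = 0) \<Longrightarrow> T = {}"
    and const: "\<And>T. T \<subseteq> {..<k} \<Longrightarrow> f (subset_sum v T) = f 0"
    by (elim exE conjE) blast
  define Q where "Q = {T. T \<subseteq> {..<k} \<and> card T \<le> D}"
  have finQ: "finite Q"
    unfolding Q_def by (rule finite_subset[of _ "Pow {..<k}"]) auto
  \<comment> \<open>The indicator of the admissible new vectors: zero on the pivots, and
    \<open>f\<close> keeps the value \<open>f 0\<close> after adding combinations of at most
    \<open>D\<close> old vectors.\<close>
  define h where "h = (\<lambda>x. (\<Prod>i\<in>I. 1 + x i) * (\<Prod>T\<in>Q. 1 + f 0 + f (subset_sum v T + x)))"
  have "lowdeg {..<m} ((\<Sum>i\<in>I. 1) + (\<Sum>T\<in>Q. D)) h"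
    unfolding h_def using I f finQ
    by (intro lowdeg_mult lowdeg_prod lowdeg_add lowdeg_const lowdeg_var lowdeg_translate) auto
  \<comment> \<open>The pivots cost at most \<open>k\<close>, less than \<open>Suc k ^ D\<close>,
    and the equations at most \<open>D * Suc k ^ D\<close>; together this stays below
    \<open>(D + 1) * Suc k ^ D\<close>.\<close>
  moreover have "(\<Sum>i\<in>I. 1) + (\<Sum>T\<in>Q. D) < m"
  proof -
    have "card Q * D \<le> Suc k ^ D * D"
      using card_small_subsets[of k D] by (intro mult_right_mono) (auto simp: Q_def)
    moreover have "Suc k \<le> Suc k ^ D"
      using assms(2) self_le_power[of "Suc k" D] by simp
    moreover have "Suc k ^ D * D + Suc k ^ D \<le> m"
      using Suc.prems by (simp add: mult.commute)
    ultimately have "card I + card Q * D < m"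
      using I(2) by linarith
    then show ?thesis by simp
  qed
  moreover have "h 0 = 1"
    unfolding h_def Q_def using const by (simp add: add.assoc)
  ultimately obtain x where x: "x \<in> F2_space m" "x \<noteq> 0" "h x = 1"
    by (rule chevalley_warning)
  have fac: "(\<Prod>i\<in>I. 1 + x i) \<noteq> 0" "(\<Prod>T\<in>Q. 1 + f 0 + f (subset_sum v T + x)) \<noteq> 0"
    using x(3) unfolding h_def by (metis mult_zero_left mult_zero_right zero_neq_one)+
  have xI: "x i = 0" if "i \<in> I" for i
    using fac(1) I(1) that by (cases "x i = 0") (auto simp: prod_zero_iff)
  have "f (x + subset_sum v T) = f 0" if "T \<subseteq> {..<k}" "card T \<le> D" for T
  proof -
    have "1 + f 0 + f (subset_sum v T + x) \<noteq> 0"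
      using fac(2) finQ that by (auto simp: Q_def prod_zero_iff)
    then show ?thesis
      by (cases "f 0"; cases "f (x + subset_sum v T)") (auto simp: add.commute)
  qed
  \<comment> \<open>The equations for small \<open>T\<close> imply those for all \<open>T\<close>,
    since \<open>f\<close> has degree at most \<open>D\<close>.\<close>
  then have constx: "f (x + subset_sum v T) = f 0" if "T \<subseteq> {..<k}" for T
    using that lowdeg_const_on_cube[OF f] by blast
  have "\<exists>i. x i = 1"
  proof (rule ccontr)
    assume "\<nexists>i. x i = 1"
    then have "x = 0"
      by (intro ext) (simp flip: bit_not_zero_iff)
    then show False using x(2) by simp
  qed
  then obtain i0 where i0: "x i0 = 1" ..
  have "i0 < m"
    using x(1) i0 by (intro notI ccontr[of "i0 < m"]) (simp add: F2_space_def not_less)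
  define v' where "v' = v(k := x)"
  have old: "subset_sum v' T = subset_sum v T" if "T \<subseteq> {..<k}" for T
    using that unfolding subset_sum_def v'_def by (intro ext sum.cong) auto
  have new: "subset_sum v' (insert k T) = x + subset_sum v T" if "T \<subseteq> {..<k}" for T
  proof -
    have "finite T" "k \<notin> T"
      using that finite_subset by auto
    then show ?thesis
      using old[OF that] by (simp add: subset_sum_insert add.commute) (simp add: v'_def)
  qed
  have split: "T \<subseteq> {..<k} \<or> (\<exists>T'\<subseteq>{..<k}. T = insert k T')" if "T \<subseteq> {..<Suc k}" for T
    using that by (cases "k \<in> T") (auto simp: lessThan_Suc subset_insert intro!: exI[of _ "T - {k}"])
  have "\<forall>i<Suc k. v' i \<in> F2_space m"
    using v x by (auto simp: v'_def less_Suc_eq)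
  moreover have "card (insert i0 I) \<le> Suc k"
    using I card_insert_le_m1[of "Suc k" I i0] by simp
  moreover have "T = {}" if T: "T \<subseteq> {..<Suc k}" "\<forall>i\<in>insert i0 I. subset_sum v' T i = 0" for T
    using split[OF T(1)]
  proof (elim disjE exE conjE)
    assume "T \<subseteq> {..<k}"
    then show ?thesis using T(2) piv[of T] old by simp
  next
    fix T' assume T': "T' \<subseteq> {..<k}" "T = insert k T'"
    then have *: "x i + subset_sum v T' i = 0" if "i \<in> insert i0 I" for i
      using T(2) that new[OF T'(1)] by auto
    then have "T' = {}"
      \<comment> \<open>As \<open>x\<close> vanishes on \<open>I\<close>, the old part alone
        vanishes on the old pivots; then \<open>i0\<close> gives the contradiction.\<close>
      using xI by (intro piv T') (metis add_0 insertCI)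
    then show ?thesis using *[of i0] i0 by simp
  qed
  moreover have "f (subset_sum v' T) = f 0" if T: "T \<subseteq> {..<Suc k}" for T
    using split[OF T] const constx old new by metis
  moreover have "finite (insert i0 I)" "insert i0 I \<subseteq> {..<m}"
    using I \<open>i0 < m\<close> by auto
  ultimately show ?case
    by (intro exI[of _ v'] exI[of _ "insert i0 I"] conjI) blast+
qed

text \<open>The subset sums of the cube form a linear subspace. Two sets with equal sums have a
  symmetric difference with sum 0, which the pivots force to be empty, so there are 2^k of
  them.\<close>

theorem k2_admissible_of_power_le:
  assumes "1 \<le> D" "(D + 1) * k ^ D \<le> m"
  shows "k2_admissible m D k"
  unfolding k2_admissible_def
proof (intro allI impI, elim conjE)
  fix p assume p: "poly_vars p \<subseteq> {..<m}" "poly_degree_le p D"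
  from exists_independent_cube[OF poly_imp_lowdeg[OF p] assms]
  obtain v I where v: "\<And>i. i < k \<Longrightarrow> v i \<in> F2_space m"
    and piv: "\<And>T. T \<subseteq> {..<k} \<Longrightarrow> (\<forall>i\<in>I. subset_sum v T i = 0) \<Longrightarrow> T = {}"
    and const: "\<And>T. T \<subseteq> {..<k} \<Longrightarrow> poly_eval p (subset_sum v T) = poly_eval p 0"
    by (elim exE conjE) blast
  let ?W = "subset_sum v ` Pow {..<k}"
  have add: "subset_sum v T + subset_sum v T' = subset_sum v ((T - T') \<union> (T' - T))"
    if "T \<subseteq> {..<k}" "T' \<subseteq> {..<k}" for T T'
    using that finite_subset[OF _ finite_lessThan] by (intro subset_sum_add) auto
  have "inj_on (subset_sum v) (Pow {..<k})"
  proof (rule inj_onI)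
    fix T T' assume T: "T \<in> Pow {..<k}" "T' \<in> Pow {..<k}" "subset_sum v T = subset_sum v T'"
    then have "subset_sum v ((T - T') \<union> (T' - T)) = 0"
      using add[of T T'] by simp
    then have "(T - T') \<union> (T' - T) = {}"
      using T by (intro piv) auto
    then show "T = T'" by blast
  qed
  then have "card ?W = 2 ^ k"
    by (simp add: card_image card_Pow)
  moreover have "\<forall>x\<in>?W. \<forall>y\<in>?W. x + y \<in> ?W"
    using add by (auto intro!: imageI)
  moreover have "?W \<subseteq> F2_space m"
    using v by (auto intro!: subset_sum_in_F2_space)
  moreover have "0 \<in> ?W"
    by (rule image_eqI[of _ _ "{}"]) auto
  moreover have "?W = (+) 0 ` ?W"
    by simp
  ultimately have "affine_subspace m k ?W"
    unfolding affine_subspace_card_iff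
    by (intro bexI[of _ 0] exI[of _ ?W] conjI F2_space_0)
  moreover have "poly_eval p constant_on ?W"
    unfolding constant_on_def using const by auto
  ultimately show "\<exists>A. affine_subspace m k A \<and> poly_eval p constant_on A"
    by blast
qed

lemma k2_admissible_k2: "k2_admissible m D (k2 m D)"
  unfolding k2_def using Max_in[OF finite_k2_admissible] k2_admissible_0 by blast

lemma k2_ge: "k2_admissible m D k \<Longrightarrow> k \<le> k2 m D"
  unfolding k2_def by (rule Max_ge[OF finite_k2_admissible]) simp

section \<open>Restricting conjunctions block by block\<close>

text \<open>A conjunction of literals, positive on \<open>P\<close> and negated on \<open>N\<close>.
  The sets may overlap; the conjunction is then contradictory.\<close>

definition cube :: "nat set \<Rightarrow> nat set \<Rightarrow> (nat \<Rightarrow> bit) \<Rightarrow> bit" where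
  "cube P N x = (\<Prod>i\<in>P. x i) * (\<Prod>i\<in>N. 1 + x i)"

text \<open>An assignment of \<open>U\<close> that falsifies no literal is determined outside
  \<open>P \<union> N\<close>. Only an inequality holds, because contradictory literals leave no
  assignment.\<close>

lemma card_compatible_subsets:
  assumes "finite U"
  shows "card {a \<in> Pow U. P \<inter> U \<subseteq> a \<and> N \<inter> U \<inter> a = {}} * 2 ^ card (U \<inter> (P \<union> N)) \<le> 2 ^ card U"
proof -
  let ?F = "{a \<in> Pow U. P \<inter> U \<subseteq> a \<and> N \<inter> U \<inter> a = {}}"
  have "inj_on (\<lambda>a. a - (P \<union> N)) ?F"
  proof (rule inj_onI)
    fix a a' assume a: "a \<in> ?F" "a' \<in> ?F" "a - (P \<union> N) = a' - (P \<union> N)"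
    then have "a \<inter> (P \<union> N) = P \<inter> U" "a' \<inter> (P \<union> N) = P \<inter> U"
      by blast+
    with a(3) show "a = a'"
      by blast
  qed
  moreover have "(\<lambda>a. a - (P \<union> N)) ` ?F \<subseteq> Pow (U - (P \<union> N))"
    by blast
  ultimately have "card ?F \<le> card (Pow (U - (P \<union> N)))"
    using assms by (intro card_inj_on_le) auto
  then have "card ?F * 2 ^ card (U \<inter> (P \<union> N)) \<le> 2 ^ card (U - (P \<union> N)) * 2 ^ card (U \<inter> (P \<union> N))"
    using assms by (simp add: card_Pow)
  also have "\<dots> = 2 ^ card U"
    using assms by (simp flip: power_add) (metis add.commute card_Int_Diff)
  finally show ?thesis .
qed

text \<open>
  The block \<open>U\<close> keeps the variable \<open>j\<close> alive, sets the variables in \<open>a\<close> to \<open>1\<close> and the others to \<open>0\<close>.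
\<close>

definition block_weight :: "real \<Rightarrow> nat set \<Rightarrow> nat set \<Rightarrow> nat set \<Rightarrow> nat \<Rightarrow> nat set \<Rightarrow> real" where
  "block_weight z U P N j a =
     (if (P - {j}) \<inter> U \<subseteq> a \<and> (N - {j}) \<inter> U \<inter> a = {} then if j \<in> P \<union> N then z else 1 else 0)"

text \<open>Let \<open>b\<close> be the block size and \<open>w\<close> the number of its variables
  read by the conjunction. A live variable among the \<open>w\<close> gives at most z * 2^b /
  2^(w-1) = b * 2^b / 2^w, any other at most 2^b / 2^w. Hence the total is at most b * (w + 1) * 2^b
  / 2^w, and w + 1 <= 2^w.\<close>

lemma sum_block_weight:
  fixes z :: real
  assumes U: "finite U" and z: "2 * z = card U"
  shows "(\<Sum>j\<in>U. \<Sum>a\<in>Pow U. block_weight z U P N j a) \<le> card U * 2 ^ card U"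
proof -
  let ?b = "card U"
  let ?r = "real (card U)"
  let ?V = "U \<inter> (P \<union> N)"
  let ?w = "card ?V"
  have bound: "(\<Sum>a\<in>Pow U. block_weight z U P N j a) \<le> (if j \<in> ?V then ?r else 1) * 2 ^ ?b / 2 ^ ?w"
    if j: "j \<in> U" for j
  proof -
    let ?F = "{a \<in> Pow U. (P - {j}) \<inter> U \<subseteq> a \<and> (N - {j}) \<inter> U \<inter> a = {}}"
    let ?c = "if j \<in> P \<union> N then z else 1"
    have "(\<Sum>a\<in>Pow U. block_weight z U P N j a) = (\<Sum>a\<in>?F. ?c)"
      using U by (intro sum.mono_neutral_cong_right) (auto simp: block_weight_def)
    also have "\<dots> = ?c * card ?F"
      by simp
    also have "\<dots> \<le> ?c * (2 ^ ?b / 2 ^ card (U \<inter> ((P - {j}) \<union> (N - {j}))))"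
    proof (intro mult_left_mono)
      have "real (card ?F * 2 ^ card (U \<inter> ((P - {j}) \<union> (N - {j})))) \<le> real (2 ^ ?b)"
        using card_compatible_subsets[OF U] by (simp only: of_nat_le_iff)
      then show "real (card ?F) \<le> 2 ^ ?b / 2 ^ card (U \<inter> ((P - {j}) \<union> (N - {j})))"
        by (simp add: field_simps)
    qed (use z in auto)
    also have "\<dots> = (if j \<in> ?V then ?r else 1) * 2 ^ ?b / 2 ^ ?w"
    proof (cases "j \<in> ?V")
      case True
      have V: "U \<inter> ((P - {j}) \<union> (N - {j})) = ?V - {j}"
        by blast
      have w: "?w = Suc (card (?V - {j}))"
        using True U by (intro card.remove) auto
      have "z * (2 ^ ?b / 2 ^ c) = ?r * 2 ^ ?b / 2 ^ Suc c" for c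
        using z by (simp add: field_simps)
      then have "z * (2 ^ ?b / 2 ^ card (?V - {j})) = ?r * 2 ^ ?b / 2 ^ ?w"
        unfolding w .
      then show ?thesis
        unfolding V using True by simp
    next
      case False
      then have "U \<inter> ((P - {j}) \<union> (N - {j})) = ?V"
        by blast
      then show ?thesis
        using False j by auto
    qed
    finally show ?thesis .
  qed
  have "(\<Sum>j\<in>U. \<Sum>a\<in>Pow U. block_weight z U P N j a)
      \<le> (\<Sum>j\<in>U. (if j \<in> ?V then ?r else 1) * 2 ^ ?b / 2 ^ ?w)"
    by (rule sum_mono[OF bound])
  also have "\<dots> \<le> (\<Sum>j\<in>U. ((if j \<in> ?V then ?r else 0) + 1) * (2 ^ ?b / 2 ^ ?w))"
    by (intro sum_mono) (auto simp: field_simps)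
  also have "\<dots> = ((\<Sum>j\<in>U. if j \<in> ?V then ?r else 0) + ?r) * (2 ^ ?b / 2 ^ ?w)"
    by (simp add: sum.distrib distrib_right sum_distrib_right[symmetric] sum_divide_distrib[symmetric])
  also have "(\<Sum>j\<in>U. if j \<in> ?V then ?r else 0) = (\<Sum>j\<in>U \<inter> ?V. ?r)"
    using U by (rule sum.inter_restrict[symmetric])
  also have "\<dots> = ?w * ?r"
    by simp
  also have "(?w * ?r + ?r) * (2 ^ ?b / 2 ^ ?w) = (real ?b * 2 ^ ?b) * ((real ?w + 1) / 2 ^ ?w)"
    by (simp add: field_simps)
  also have "\<dots> \<le> real ?b * 2 ^ ?b * 1"
  proof (intro mult_left_mono)
    have "?w + 1 \<le> 2 ^ ?w"
      using less_exp[of ?w] by linarith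
    then have "real (?w + 1) \<le> real (2 ^ ?w)"
      by (simp only: of_nat_le_iff)
    then show "(real ?w + 1) / 2 ^ ?w \<le> 1"
      by simp
  qed auto
  finally show ?thesis by simp
qed

text \<open>Averaging over the \<open>card U * 2 ^ card U\<close> choices; \<open>\<omega> g\<close>
  is the weight that \<open>g\<close> carries from earlier blocks.\<close>

lemma exists_block_choice:
  fixes z :: real
  assumes U: "finite U" "U \<noteq> {}" and z: "2 * z = card U" and \<omega>: "\<And>g. g \<in> G \<Longrightarrow> 0 \<le> \<omega> g"
  obtains j a where "j \<in> U" "a \<subseteq> U"
    "(\<Sum>g\<in>G. \<omega> g * block_weight z U (P g) (N g) j a) \<le> (\<Sum>g\<in>G. \<omega> g)"
proof (rule ccontr)
  let ?f = "\<lambda>j a. \<Sum>g\<in>G. \<omega> g * block_weight z U (P g) (N g) j a"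
  note choice = that
  assume "\<not> thesis"
  then have gt: "(\<Sum>g\<in>G. \<omega> g) < ?f j a" if "j \<in> U" "a \<in> Pow U" for j a
    using choice[of j a] that by force
  have "(\<Sum>x\<in>U \<times> Pow U. (\<Sum>g\<in>G. \<omega> g)) < (\<Sum>x\<in>U \<times> Pow U. ?f (fst x) (snd x))"
    by (rule sum_strict_mono) (use U gt in auto)
  also have "\<dots> = (\<Sum>j\<in>U. \<Sum>a\<in>Pow U. ?f j a)"
    by (subst sum.cartesian_product) (simp add: case_prod_beta)
  also have "\<dots> = (\<Sum>g\<in>G. \<omega> g * (\<Sum>j\<in>U. \<Sum>a\<in>Pow U. block_weight z U (P g) (N g) j a))"
    by (simp add: sum_distrib_left sum.swap[of _ G])
  also have "\<dots> \<le> (\<Sum>g\<in>G. \<omega> g * (card U * 2 ^ card U))"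
    using sum_block_weight[OF U(1) z] \<omega> by (intro sum_mono mult_left_mono) auto
  also have "\<dots> = (\<Sum>x\<in>U \<times> Pow U. (\<Sum>g\<in>G. \<omega> g))"
    using U by (simp add: card_cartesian_product card_Pow sum_distrib_right[symmetric] mult.commute)
  finally show False by simp
qed

lemma exists_block_choices:
  fixes B :: "nat \<Rightarrow> nat set" and z :: real
  assumes B: "\<And>i. finite (B i)" "\<And>i. card (B i) = b" and b: "0 < b" and z: "2 * z = real b"
  shows "\<exists>j a. (\<forall>i<M. j i \<in> B i \<and> a i \<subseteq> B i) \<and>
    (\<Sum>g\<in>G. \<Prod>i<M. block_weight z (B i) (P g) (N g) (j i) (a i)) \<le> real (card G)"
proof (induction M)
  case 0
  show ?case by simp
next
  case (Suc M)
  then obtain j a where IH: "\<And>i. i < M \<Longrightarrow> j i \<in> B i" "\<And>i. i < M \<Longrightarrow> a i \<subseteq> B i"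
    "(\<Sum>g\<in>G. \<Prod>i<M. block_weight z (B i) (P g) (N g) (j i) (a i)) \<le> real (card G)"
    by auto
  have "B M \<noteq> {}"
    using B b by (metis card.empty not_less_zero)
  moreover have "0 \<le> (\<Prod>i<M. block_weight z (B i) (P g) (N g) (j i) (a i))" for g
    using z by (intro prod_nonneg) (auto simp: block_weight_def)
  ultimately obtain j' a' where new: "j' \<in> B M" "a' \<subseteq> B M"
    "(\<Sum>g\<in>G. (\<Prod>i<M. block_weight z (B i) (P g) (N g) (j i) (a i)) * block_weight z (B M) (P g) (N g) j' a')
      \<le> (\<Sum>g\<in>G. \<Prod>i<M. block_weight z (B i) (P g) (N g) (j i) (a i))"
    using exists_block_choice[where U = "B M" and z = z and G = G and P = P and N = N and
        \<omega> = "\<lambda>g. \<Prod>i<M. block_weight z (B i) (P g) (N g) (j i) (a i)"] B z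
    by auto
  have "(\<Sum>g\<in>G. \<Prod>i<Suc M. block_weight z (B i) (P g) (N g) ((j(M := j')) i) ((a(M := a')) i)) \<le> real (card G)"
    using new(3) IH(3) by simp
  then show ?case
    using IH new by (intro exI[of _ "j(M := j')"] exI[of _ "a(M := a')"]) (auto simp: less_Suc_eq)
qed

text \<open>A surviving conjunction with \<open>w\<close> live literals has weight z^w, which is at
  most the total weight, hence at most \<open>card G\<close>, hence less than z^(D+1). As z >= 1,
  this gives w <= D.\<close>

lemma exists_block_restriction:
  fixes B :: "nat \<Rightarrow> nat set" and b D :: nat
  assumes B: "\<And>i. finite (B i)" "\<And>i. card (B i) = b" and b: "2 \<le> b"
    and G: "finite G" "real (card G) < (b / 2) ^ Suc D"
  obtains j a where "\<forall>i<M. j i \<in> B i \<and> a i \<subseteq> B i"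
    "\<forall>g\<in>G. (\<forall>i<M. (P g - {j i}) \<inter> B i \<subseteq> a i \<and> (N g - {j i}) \<inter> B i \<inter> a i = {})
       \<longrightarrow> card {i. i < M \<and> j i \<in> P g \<union> N g} \<le> D"
proof -
  define z where "z = real b / 2"
  have z: "2 * z = real b" "1 \<le> z"
    using b by (auto simp: z_def)
  obtain j a where ja: "\<forall>i<M. j i \<in> B i \<and> a i \<subseteq> B i"
    and sum: "(\<Sum>g\<in>G. \<Prod>i<M. block_weight z (B i) (P g) (N g) (j i) (a i)) \<le> real (card G)"
    using exists_block_choices[where B = B and b = b and z = z and M = M and G = G and P = P and N = N] B b z
    by auto
  have "card {i. i < M \<and> j i \<in> P g \<union> N g} \<le> D"
    if g: "g \<in> G" and sat: "\<forall>i<M. (P g - {j i}) \<inter> B i \<subseteq> a i \<and> (N g - {j i}) \<inter> B i \<inter> a i = {}" for g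
  proof -
    let ?I = "{i. i < M \<and> j i \<in> P g \<union> N g}"
    have "z ^ card ?I = (\<Prod>i\<in>{..<M} \<inter> ?I. z)"
      by (simp add: Int_absorb1 subset_eq)
    also have "\<dots> = (\<Prod>i<M. if i \<in> ?I then z else 1)"
      by (rule prod.inter_restrict) simp
    also have "\<dots> = (\<Prod>i<M. block_weight z (B i) (P g) (N g) (j i) (a i))"
      using sat by (intro prod.cong) (auto simp: block_weight_def)
    also have "\<dots> \<le> (\<Sum>g\<in>G. \<Prod>i<M. block_weight z (B i) (P g) (N g) (j i) (a i))"
      using G g z by (intro member_le_sum prod_nonneg) (auto simp: block_weight_def)
    also have "\<dots> < z ^ Suc D"
      using sum G by (simp add: z_def)
    finally have "z ^ card ?I < z ^ Suc D" .
    then have "card ?I < Suc D"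
      using z(2) power_less_imp_less_exp[of z] power_increasing[of "Suc D" "card ?I" z] by (meson not_le)
    then show ?thesis by simp
  qed
  then show ?thesis
    using that ja by blast
qed

section \<open>Restrictions as affine embeddings\<close>

text \<open>The linear part of a restriction: live variable \<open>i\<close> sits at coordinate
  \<open>j i\<close>. Written as a sum, it is additive for every \<open>j\<close>.\<close>

definition embed :: "(nat \<Rightarrow> nat) \<Rightarrow> nat \<Rightarrow> (nat \<Rightarrow> bit) \<Rightarrow> nat \<Rightarrow> bit" where
  "embed j M y = (\<lambda>l. \<Sum>i<M. of_bool (l = j i) * y i)"

lemma embed_add: "embed j M (x + y) = embed j M x + embed j M y"
  by (simp add: embed_def fun_eq_iff distrib_left sum.distrib)

lemma embed_image:
  assumes "inj_on j {..<M}" "i < M"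
  shows "embed j M y (j i) = y i"
proof -
  have "embed j M y (j i) = (\<Sum>i'<M. if i' = i then y i' else 0)"
    unfolding embed_def using assms by (intro sum.cong) (auto simp: inj_on_def)
  then show ?thesis
    using assms by simp
qed

lemma embed_outside: "l \<notin> j ` {..<M} \<Longrightarrow> embed j M y l = 0"
  unfolding embed_def by (intro sum.neutral) auto

lemma inj_on_embed:
  assumes "inj_on j {..<M}"
  shows "inj_on (embed j M) (F2_space M)"
proof (intro inj_onI ext)
  fix x y i assume xy: "x \<in> F2_space M" "y \<in> F2_space M" "embed j M x = embed j M y"
  show "x i = y i"
  proof (cases "i < M")
    case True
    then show ?thesis using embed_image[OF assms] xy(3) by metis
  next
    case False
    then show ?thesis using xy(1,2) by (simp add: F2_space_def)
  qed
qed

text \<open>Fixed coordinates get degree 0 and live ones degree 1, so the degree of a restricted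
  conjunction counts its live literals only.\<close>

lemma lowdeg_embed_coord:
  assumes "inj_on j {..<M}"
  shows "lowdeg {..<M} (of_bool (l \<in> j ` {..<M})) (\<lambda>y. s l + embed j M y l)"
proof (cases "l \<in> j ` {..<M}")
  case True
  then obtain i where "i < M" "l = j i" by blast
  then show ?thesis
    using embed_image[OF assms] by (auto intro!: lowdeg_add lowdeg_const lowdeg_var)
next
  case False
  then show ?thesis
    by (simp add: embed_outside lowdeg_const)
qed

lemma lowdeg_embed:
  assumes j: "inj_on j {..<M}" and f: "lowdeg V D f"
  shows "lowdeg {..<M} D (\<lambda>y. f (s + embed j M y))"
  using f
proof (induction rule: lowdeg.induct)
  case lowdeg_0
  show ?case by (rule lowdeg.lowdeg_0)
next
  case (lowdeg_add_mono A f)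
  have "lowdeg {..<M} (\<Sum>l\<in>A. of_bool (l \<in> j ` {..<M})) (\<lambda>y. \<Prod>l\<in>A. s l + embed j M y l)"
    using lowdeg_add_mono by (intro lowdeg_prod lowdeg_embed_coord j)
  moreover have "(\<Sum>l\<in>A. of_bool (l \<in> j ` {..<M})) \<le> D"
  proof -
    have "(\<Sum>l\<in>A. of_bool (l \<in> j ` {..<M})) \<le> (\<Sum>l\<in>A. 1::nat)"
      by (intro sum_mono) auto
    then show ?thesis using lowdeg_add_mono by simp
  qed
  ultimately have "lowdeg {..<M} D (\<lambda>y. \<Prod>l\<in>A. s l + embed j M y l)"
    by (elim lowdeg_mono) auto
  then show ?case
    using lowdeg_add_mono by (simp add: lowdeg_add)
qed

lemma cube_eq_0:
  assumes "finite P" "finite N" "(\<exists>i\<in>P. x i = 0) \<or> (\<exists>i\<in>N. x i = 1)"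
  shows "cube P N x = 0"
  using assms by (auto simp: cube_def prod_zero_iff)

lemma cube_eq_1_iff:
  assumes "finite P" "finite N"
  shows "cube P N x = 1 \<longleftrightarrow> (\<forall>i\<in>P. x i = 1) \<and> (\<forall>i\<in>N. x i = 0)"
proof -
  have "cube P N x = 1" if "\<forall>i\<in>P. x i = 1" "\<forall>i\<in>N. x i = 0"
    using that by (simp add: cube_def)
  moreover have "cube P N x = 0" if "\<not> ((\<forall>i\<in>P. x i = 1) \<and> (\<forall>i\<in>N. x i = 0))"
    using that by (intro cube_eq_0 assms) auto
  ultimately show ?thesis
    by (metis zero_neq_one)
qed

lemma lowdeg_embed_cube:
  assumes j: "inj_on j {..<M}" and fin: "finite P" "finite N" and "P \<inter> N = {}"
    and D: "card {i. i < M \<and> j i \<in> P \<union> N} \<le> D"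
  shows "lowdeg {..<M} D (\<lambda>y. cube P N (s + embed j M y))"
proof -
  let ?d = "\<lambda>l. of_bool (l \<in> j ` {..<M}) :: nat"
  have "lowdeg {..<M} ((\<Sum>l\<in>P. ?d l) + (\<Sum>l\<in>N. ?d l))
          (\<lambda>y. (\<Prod>l\<in>P. s l + embed j M y l) * (\<Prod>l\<in>N. 1 + (s l + embed j M y l)))"
    by (intro lowdeg_mult lowdeg_prod lowdeg_embed_coord lowdeg_add[OF lowdeg_const] j fin)
  moreover have "(\<Sum>l\<in>P. ?d l) + (\<Sum>l\<in>N. ?d l) = (\<Sum>l\<in>P \<union> N. ?d l)"
    using fin assms(4) by (intro sum.union_disjoint[symmetric])
  moreover have "(\<Sum>l\<in>P \<union> N. ?d l) = card ((P \<union> N) \<inter> j ` {..<M})"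
    using fin by simp
  moreover have "(P \<union> N) \<inter> j ` {..<M} = j ` {i. i < M \<and> j i \<in> P \<union> N}"
    by blast
  then have "card ((P \<union> N) \<inter> j ` {..<M}) \<le> card {i. i < M \<and> j i \<in> P \<union> N}"
    by (simp add: card_image_le)
  ultimately show ?thesis
    using D by (auto simp: cube_def elim!: lowdeg_mono)
qed

lemma exists_restriction:
  fixes n M b D :: nat
  assumes b: "2 \<le> b" "M * b \<le> n" and G: "finite G" "real (card G) < (b / 2) ^ Suc D"
    and PN: "\<And>g. g \<in> G \<Longrightarrow> P g \<subseteq> {..<n}" "\<And>g. g \<in> G \<Longrightarrow> N g \<subseteq> {..<n}"
  obtains s j where "s \<in> F2_space n" "inj_on j {..<M}" "j ` {..<M} \<subseteq> {..<n}"
    "\<And>g. g \<in> G \<Longrightarrow> lowdeg {..<M} D (\<lambda>y. cube (P g) (N g) (s + embed j M y))"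
proof -
  define B where "B i = {i * b..<Suc i * b}" for i :: nat
  have B: "finite (B i)" "card (B i) = b" for i
    by (simp_all add: B_def)
  have disj: "i = i'" if "l \<in> B i" "l \<in> B i'" for i i' l
  proof -
    have "l div b = i" if "l \<in> B i" for i
      using that by (intro div_nat_eqI) (auto simp: B_def mult.commute)
    then show ?thesis using that by blast
  qed
  obtain j a where ja: "\<forall>i<M. j i \<in> B i \<and> a i \<subseteq> B i"
    and few: "\<forall>g\<in>G. (\<forall>i<M. (P g - {j i}) \<inter> B i \<subseteq> a i \<and> (N g - {j i}) \<inter> B i \<inter> a i = {})
       \<longrightarrow> card {i. i < M \<and> j i \<in> P g \<union> N g} \<le> D"
    by (rule exists_block_restriction[where B = B and b = b and D = D and G = G and M = M and P = P and N = N, OF B b(1) G])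
  have j: "j i \<in> B i" and a: "a i \<subseteq> B i" if "i < M" for i
    using ja that by auto
  have Bn: "B i \<subseteq> {..<n}" if "i < M" for i
  proof -
    have "Suc i * b \<le> M * b"
      using that by (intro mult_right_mono) auto
    then show ?thesis
      using b(2) by (auto simp: B_def)
  qed
  have inj: "inj_on j {..<M}"
    using j disj by (metis inj_onI lessThan_iff)
  \<comment> \<open>Variables outside all blocks are set to 0; removing \<open>j i\<close> leaves
    the live variables unshifted.\<close>
  define s :: "nat \<Rightarrow> bit" where "s l = of_bool (l \<in> (\<Union>i<M. a i - {j i}))" for l
  have s: "s \<in> F2_space n"
    using a Bn by (fastforce simp: F2_space_def s_def)
  have s_block: "s l = of_bool (l \<in> a i)" if "i < M" "l \<in> B i" "l \<noteq> j i" for i l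
  proof -
    have "l \<in> (\<Union>i<M. a i - {j i}) \<longleftrightarrow> l \<in> a i"
      using that a disj by blast
    then show ?thesis
      by (simp only: s_def)
  qed
  have emb_block: "embed j M y l = 0" if "i < M" "l \<in> B i" "l \<noteq> j i" for i l y
  proof (intro embed_outside notI)
    assume "l \<in> j ` {..<M}"
    then obtain i' where i': "i' < M" "l = j i'" by blast
    then have "i = i'"
      using disj[OF that(2)] j by simp
    then show False using i' that(3) by simp
  qed
  have "lowdeg {..<M} D (\<lambda>y. cube (P g) (N g) (s + embed j M y))" if g: "g \<in> G" for g
  proof -
    have fin: "finite (P g)" "finite (N g)"
      using PN(1,2)[OF g] by (auto intro: finite_subset[OF _ finite_lessThan])
    \<comment> \<open>Contradictory conjunctions and those falsified by a fixed variable become 0;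
      only the remaining ones need the bound on live literals.\<close>
    consider (disj) "P g \<inter> N g \<noteq> {}"
      | (killed) i l where "i < M" "l \<in> B i" "l \<noteq> j i" "l \<in> P g \<and> l \<notin> a i \<or> l \<in> N g \<and> l \<in> a i"
      | (alive) "P g \<inter> N g = {}"
          "\<forall>i<M. (P g - {j i}) \<inter> B i \<subseteq> a i \<and> (N g - {j i}) \<inter> B i \<inter> a i = {}"
      by blast
    then show ?thesis
    proof cases
      case disj
      then obtain l where l: "l \<in> P g" "l \<in> N g" by blast
      have "cube (P g) (N g) x = 0" for x
        using l by (cases "x l = 0") (auto intro!: cube_eq_0 fin)
      then show ?thesis by (simp add: lowdeg_0)
    next
      case killed
      have "cube (P g) (N g) (s + embed j M y) = 0" for y
        using killed s_block[OF killed(1-3)] emb_block[OF killed(1-3)]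
        by (intro cube_eq_0 fin) force
      then show ?thesis by (simp add: lowdeg_0)
    next
      case alive
      then show ?thesis
        using few g by (intro lowdeg_embed_cube inj fin) auto
    qed
  qed
  moreover have "j ` {..<M} \<subseteq> {..<n}"
    using j Bn by blast
  ultimately show ?thesis
    using that s inj by blast
qed

lemma affine_subspace_embed:
  assumes "affine_subspace M k A" "s \<in> F2_space n" "inj_on j {..<M}" "j ` {..<M} \<subseteq> {..<n}"
  shows "affine_subspace n k ((\<lambda>y. s + embed j M y) ` A)"
proof (rule affine_subspace_image[OF assms(1,2)])
  have "embed j M y l = 0" if "n \<le> l" for y l
    using assms(4) that by (intro embed_outside) auto
  then show "embed j M ` F2_space M \<subseteq> F2_space n"
    by (auto simp: F2_space_def)
qed (auto simp: embed_add inj_on_embed assms)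

section \<open>Subspaces on which a prescribed value is taken\<close>

text \<open>The value is recorded because AND and OR gates are decided by one particular value of a
  child.\<close>

definition takes_on :: "nat \<Rightarrow> nat \<Rightarrow> ((nat \<Rightarrow> bit) \<Rightarrow> bit) \<Rightarrow> bit \<Rightarrow> bool" where
  "takes_on n k f v \<longleftrightarrow> (\<exists>A. affine_subspace n k A \<and> (\<forall>x\<in>A. f x = v))"

lemma takes_on_mono: "takes_on n K f v \<Longrightarrow> k \<le> K \<Longrightarrow> takes_on n k f v"
  unfolding takes_on_def by (meson affine_subspace_mono subsetD)

text \<open>The level set of \<open>f\<close> through \<open>a\<close> is a coset of
  \<open>?W\<close>, and \<open>?W\<close> has index at most 2: if \<open>f u\<close> differs from
  \<open>f 0\<close>, translation by \<open>u\<close> exchanges \<open>?W\<close> with its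
  complement.\<close>

lemma takes_on_affine:
  assumes f: "lowdeg V 1 f" and a: "a \<in> F2_space n" "f a = v"
  shows "takes_on n (n - 1) f v"
proof -
  let ?W = "{w \<in> F2_space n. f w = f 0}"
  note aff = lowdeg_affine[OF f]
  have W: "0 \<in> ?W" "\<forall>x\<in>?W. \<forall>y\<in>?W. x + y \<in> ?W" "?W \<subseteq> F2_space n"
    by (auto simp: F2_space_0 aff intro!: F2_space_add)
  obtain k where k: "card ?W = 2 ^ k" "n - 1 \<le> k"
  proof (cases "\<exists>u\<in>F2_space n. f u \<noteq> f 0")
    case False
    then have "?W = F2_space n" by blast
    then show ?thesis using that[of n] card_F2_space by simp
  next
    case True
    then obtain u where u: "u \<in> F2_space n" "f u \<noteq> f 0" by blast
    have "bij_betw ((+) u) ?W (F2_space n - ?W)"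
    proof (rule bij_betw_byWitness[where f' = "(+) u"])
      show "(+) u ` ?W \<subseteq> F2_space n - ?W"
        using u by (auto simp: aff F2_space_add)
      show "(+) u ` (F2_space n - ?W) \<subseteq> ?W"
        using u by (auto simp: aff F2_space_add) (metis bit_add_eq_0_iff bit_not_zero_iff one_add_one bit_2_eq_0 add.commute add_0)
    qed auto
    then have "card ?W = card (F2_space n - ?W)"
      by (rule bij_betw_same_card)
    also have "\<dots> = 2 ^ n - card ?W"
      using finite_F2_space by (subst card_Diff_subset) (auto simp: card_F2_space)
    finally have two: "2 * card ?W = 2 ^ n"
      using card_mono[OF finite_F2_space W(3)] by (simp add: card_F2_space)
    have "n \<noteq> 0"
      using two by (intro notI) simp
    then have "card ?W = 2 ^ (n - 1)"
      using two by (cases n) auto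
    then show ?thesis using that[of "n - 1"] by simp
  qed
  have "affine_subspace n k ((+) a ` ?W)"
    unfolding affine_subspace_card_iff using a W k by (intro bexI[of _ a] exI[of _ ?W] conjI) auto
  moreover have "f x = v" if "x \<in> (+) a ` ?W" for x
    using that a by (auto simp: aff)
  ultimately have "takes_on n k f v"
    unfolding takes_on_def by blast
  then show ?thesis
    using k(2) takes_on_mono by blast
qed

lemma takes_on_cube:
  assumes PN: "P \<subseteq> {..<n}" "N \<subseteq> {..<n}" "P \<inter> N = {}"
  shows "takes_on n (n - card (P \<union> N)) (cube P N) 1"
proof -
  have fin: "finite P" "finite N"
    using PN(1,2) by (auto intro: finite_subset[OF _ finite_lessThan])
  let ?U = "{..<n} - (P \<union> N)"
  let ?a = "\<lambda>i. of_bool (i \<in> P) :: bit"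
  have "affine_subspace n (card ?U) {x. \<forall>i. i \<notin> ?U \<longrightarrow> x i = ?a i}"
    using PN by (intro affine_subspace_coords) (auto simp: F2_space_def)
  moreover have "card ?U = n - card (P \<union> N)"
    using PN fin by (simp add: card_Diff_subset)
  moreover have "cube P N x = 1" if "\<forall>i. i \<notin> ?U \<longrightarrow> x i = ?a i" for x
    using that PN fin by (auto simp: cube_eq_1_iff)
  ultimately show ?thesis
    unfolding takes_on_def by auto
qed

section \<open>Depth-2 circuits\<close>

lemma takes_on_embed:
  assumes "takes_on M k (\<lambda>y. f (s + embed j M y)) v"
    and "s \<in> F2_space n" "inj_on j {..<M}" "j ` {..<M} \<subseteq> {..<n}"
  shows "takes_on n k f v"
  using assms affine_subspace_embed[OF _ assms(2-4)] unfolding takes_on_def by blast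

lemma takes_on_k2:
  assumes "lowdeg {..<m} D f"
  shows "\<exists>v. takes_on m (k2 m D) f v"
proof -
  obtain p where p: "poly_vars p \<subseteq> {..<m}" "poly_degree_le p D" "poly_eval p = f"
    using lowdeg_imp_poly[OF assms] .
  then obtain A where "affine_subspace m (k2 m D) A" "f constant_on A"
    using k2_admissible_k2[of m D] unfolding k2_admissible_def by metis
  then show ?thesis
    unfolding takes_on_def constant_on_def by metis
qed

text \<open>On the first \<open>m\<close> coordinates every function has degree at most
  \<open>m\<close>, so the definition of \<open>k2\<close> applies with no assumption on
  \<open>f\<close>.\<close>

lemma takes_on_k2_large_degree:
  assumes "m \<le> D" "m \<le> n"
  shows "\<exists>v. takes_on n (k2 m D) f v"
proof -
  obtain g where g: "lowdeg {..<m} m g" "\<And>x. x \<in> F2_space m \<Longrightarrow> g x = f x"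
    using lowdeg_universal[of m f] by blast
  obtain v A where A: "affine_subspace m (k2 m D) A" "\<forall>x\<in>A. g x = v"
    using takes_on_k2[OF lowdeg_mono[OF g(1) subset_refl assms(1)]] unfolding takes_on_def by blast
  then have "\<forall>x\<in>A. f x = v"
    using g(2) affine_subspace_subset[OF A(1)] by (metis subsetD)
  then show ?thesis
    unfolding takes_on_def using affine_subspace_enlarge_space[OF A(1) assms(2)] by blast
qed

lemma takes_on_coord: "l < n \<Longrightarrow> takes_on n (n - 1) (\<lambda>x. x l) v"
  by (rule takes_on_affine[of "{l}" _ "\<lambda>i. if i = l then v else 0"]) (auto intro: lowdeg_var simp: F2_space_def)

text \<open>The first \<open>m\<close> variables stay free. A wide conjunction still reads at least
  \<open>n - 2 * m\<close> of the others, so at most a fraction 2^-(n - 2m) of their assignments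
  fails to falsify it. A union bound over \<open>G\<close> leaves an assignment that falsifies
  all.\<close>

lemma avoid_wide_cubes:
  assumes G: "finite G" "card G < 2 ^ (n - 2 * m)" and m: "2 * m \<le> n"
    and PN: "\<And>g. g \<in> G \<Longrightarrow> P g \<subseteq> {..<n}" "\<And>g. g \<in> G \<Longrightarrow> N g \<subseteq> {..<n}"
    and wide: "\<And>g. g \<in> G \<Longrightarrow> n - m < card (P g \<union> N g)"
  shows "\<exists>A. affine_subspace n m A \<and> (\<forall>x\<in>A. \<forall>g\<in>G. cube (P g) (N g) x = 0)"
proof -
  let ?U = "{m..<n}"
  define F where "F g = {a \<in> Pow ?U. P g \<inter> ?U \<subseteq> a \<and> N g \<inter> ?U \<inter> a = {}}" for g
  have F: "card (F g) * 2 ^ (n - 2 * m) \<le> 2 ^ (n - m)" if g: "g \<in> G" for g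
  proof -
    have "P g \<union> N g \<subseteq> (?U \<inter> (P g \<union> N g)) \<union> {..<m}"
      using PN[OF g] by auto
    then have "card (P g \<union> N g) \<le> card ((?U \<inter> (P g \<union> N g)) \<union> {..<m})"
      by (intro card_mono) auto
    also have "\<dots> \<le> card (?U \<inter> (P g \<union> N g)) + m"
      using card_Un_le[of "?U \<inter> (P g \<union> N g)" "{..<m}"] by simp
    finally have "n - 2 * m \<le> card (?U \<inter> (P g \<union> N g))"
      using wide[OF g] by linarith
    then have "card (F g) * 2 ^ (n - 2 * m) \<le> card (F g) * 2 ^ card (?U \<inter> (P g \<union> N g))"
      by (intro mult_left_mono power_increasing) auto
    also have "\<dots> \<le> 2 ^ card ?U"
      unfolding F_def by (rule card_compatible_subsets) simp
    finally show ?thesis by simp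
  qed
  have "card (\<Union>g\<in>G. F g) * 2 ^ (n - 2 * m) \<le> (\<Sum>g\<in>G. card (F g)) * 2 ^ (n - 2 * m)"
    using G by (intro mult_right_mono card_UN_le) auto
  also have "\<dots> \<le> (\<Sum>g\<in>G. 2 ^ (n - m))"
    unfolding sum_distrib_right using F by (intro sum_mono)
  also have "\<dots> < 2 ^ (n - m) * 2 ^ (n - 2 * m)"
    using G by (simp add: mult.commute)
  finally have "card (\<Union>g\<in>G. F g) < card (Pow ?U)"
    by (simp add: card_Pow)
  then have "\<not> Pow ?U \<subseteq> (\<Union>g\<in>G. F g)"
    using G card_mono[of "\<Union>g\<in>G. F g" "Pow ?U"] by (auto simp: F_def)
  then obtain a where a: "a \<subseteq> ?U" "\<And>g. g \<in> G \<Longrightarrow> a \<notin> F g"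
    by blast
  let ?A = "{x. \<forall>i. i \<notin> {..<m} \<longrightarrow> x i = (of_bool (i \<in> a) :: bit)}"
  have "affine_subspace n (card {..<m}) ?A"
    using a m by (intro affine_subspace_coords) (auto simp: F2_space_def)
  moreover have "cube (P g) (N g) x = 0" if x: "x \<in> ?A" and g: "g \<in> G" for x g
  proof -
    have fin: "finite (P g)" "finite (N g)"
      using PN(1,2)[OF g] by (auto intro: finite_subset[OF _ finite_lessThan])
    have "(\<exists>l\<in>P g. l \<in> ?U \<and> l \<notin> a) \<or> (\<exists>l\<in>N g. l \<in> ?U \<and> l \<in> a)"
      using a(2)[OF g] a(1) unfolding F_def by blast
    moreover have "l \<in> ?U \<Longrightarrow> l \<notin> a \<Longrightarrow> x l = 0" "l \<in> ?U \<Longrightarrow> l \<in> a \<Longrightarrow> x l = 1" for l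
      using x by auto
    ultimately have "(\<exists>l\<in>P g. x l = 0) \<or> (\<exists>l\<in>N g. x l = 1)"
      by blast
    then show ?thesis
      by (rule cube_eq_0[OF fin])
  qed
  ultimately show ?thesis
    by (intro exI[of _ ?A]) auto
qed

section \<open>Bottom gates as affine functions or conjunctions\<close>

lemma circuit_depth_child:
  assumes "circuit_depth (Gate g cs) \<le> Suc d" "h \<in> set cs"
  shows "circuit_depth h \<le> d"
  using assms by simp

lemma literal_cases:
  assumes "circuit_depth h \<le> 0"
  obtains i where "h = Pos i" | i where "h = Neg i"
  using assms by (cases h) auto

lemma lowdeg_literal:
  assumes "circuit_depth h \<le> 0" "circuit_vars h \<subseteq> V"
  shows "lowdeg V 1 (circuit_eval h)"
  using assms by (cases h) (auto intro!: lowdeg_var lowdeg_add[OF lowdeg_const])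

text \<open>Literals and XOR gates are affine, AND gates are conjunctions, and OR gates are
  complements of conjunctions. The second case records that \<open>h\<close> is a gate, since only
  gates count towards the size.\<close>

lemma depth_le_1_cases:
  assumes d: "circuit_depth h \<le> 1" and vars: "circuit_vars h \<subseteq> V" "finite V"
  obtains (affine) "lowdeg V 1 (circuit_eval h)"
  | (cube) u P N where "\<exists>g ds. h = Gate g ds" "P \<subseteq> V" "N \<subseteq> V" "\<And>x. circuit_eval h x = u + cube P N x"
proof (cases h)
  case (Gate g ds)
  have lit: "circuit_depth d \<le> 0" if "d \<in> set ds" for d
    using circuit_depth_child[of g ds 0 d] that assms(1) Gate by simp
  define P where "P = {i. Pos i \<in> set ds}"
  define N where "N = {i. Neg i \<in> set ds}"
  have "circuit_vars d \<subseteq> V" if "d \<in> set ds" for d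
    using vars(1) Gate that by auto
  from this[of "Pos i" for i] this[of "Neg i" for i] have PN: "P \<subseteq> V" "N \<subseteq> V"
    by (auto simp: P_def N_def)
  then have fin: "finite P" "finite N"
    using vars(2) by (auto intro: finite_subset)
  have all1: "(\<forall>d\<in>set ds. circuit_eval d x = 1) \<longleftrightarrow> cube P N x = 1" for x
  proof -
    have "circuit_eval d x = 1" if "d \<in> set ds" "\<forall>i\<in>P. x i = 1" "\<forall>i\<in>N. x i = 0" for d
      using lit[OF that(1)] that by (elim literal_cases) (auto simp: P_def N_def)
    moreover have "x i = 1" if "\<forall>d\<in>set ds. circuit_eval d x = 1" "i \<in> P" for i
      using that by (force simp: P_def)
    moreover have "x i = 0" if "\<forall>d\<in>set ds. circuit_eval d x = 1" "i \<in> N" for i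
    proof -
      have "circuit_eval (Neg i) x = 1"
        using that unfolding N_def by blast
      then show ?thesis by (cases "x i = 0") auto
    qed
    ultimately show ?thesis
      unfolding cube_eq_1_iff[OF fin] by blast
  qed
  have all0: "(\<forall>d\<in>set ds. circuit_eval d x = 0) \<longleftrightarrow> cube N P x = 1" for x
  proof -
    have "circuit_eval d x = 0" if "d \<in> set ds" "\<forall>i\<in>N. x i = 1" "\<forall>i\<in>P. x i = 0" for d
      using lit[OF that(1)] that by (elim literal_cases) (auto simp: P_def N_def)
    moreover have "x i = 0" if "\<forall>d\<in>set ds. circuit_eval d x = 0" "i \<in> P" for i
      using that by (force simp: P_def)
    moreover have "x i = 1" if "\<forall>d\<in>set ds. circuit_eval d x = 0" "i \<in> N" for i
    proof -
      have "circuit_eval (Neg i) x = 0"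
        using that unfolding N_def by blast
      then show ?thesis by (cases "x i = 0") auto
    qed
    ultimately show ?thesis
      unfolding cube_eq_1_iff[OF fin(2,1)] by blast
  qed
  show ?thesis
  proof (cases g)
    case AND
    have "circuit_eval h x = 0 + cube P N x" for x
      using all1[of x] by (cases "cube P N x = 0") (auto simp: Gate AND)
    then show ?thesis
      using cube[of P N 0] PN Gate by blast
  next
    case OR
    \<comment> \<open>De Morgan: complementing the disjunction negates each literal, hence swaps
      \<open>P\<close> and \<open>N\<close>.\<close>
    have "circuit_eval h x = 1 + cube N P x" for x
      using all0[of x] by (cases "cube N P x = 0") (auto simp: Gate OR)
    then show ?thesis
      using cube[of N P 1] PN Gate by blast
  next
    case XOR
    have "lowdeg V 1 (circuit_eval d)" if "d \<in> set ds" for d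
      using lit[OF that] vars(1) that Gate by (intro lowdeg_literal) auto
    then have "lowdeg V 1 (\<lambda>x. \<Sum>d\<leftarrow>ds. circuit_eval d x)"
      by (rule lowdeg_sum_list)
    then show ?thesis
      by (intro affine) (simp add: Gate XOR o_def)
  qed
qed (use affine lowdeg_literal[of h V] vars(1) in simp_all)

text \<open>\<open>v\<close> is the value that decides the gate above. A child that neither attains
  \<open>v\<close> on a large subspace nor avoids it everywhere must be a conjunction, up to a
  constant, too wide to have all its literals fixed.\<close>

lemma depth_le_1_takes_on:
  assumes d: "circuit_depth h \<le> 1" and vars: "circuit_vars h \<subseteq> {..<n}" and m: "m < n" "K \<le> m"
  obtains (takes) "takes_on n K (circuit_eval h) v"
  | (avoids) "\<And>x. x \<in> F2_space n \<Longrightarrow> circuit_eval h x = 1 + v"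
  | (wide) P N where "\<exists>g ds. h = Gate g ds" "P \<subseteq> {..<n}" "N \<subseteq> {..<n}" "n - m < card (P \<union> N)"
      "\<And>x. circuit_eval h x = 1 + v + cube P N x"
  using d vars finite_lessThan
proof (cases rule: depth_le_1_cases)
  case affine
  show ?thesis
  proof (cases "\<exists>a\<in>F2_space n. circuit_eval h a = v")
    case True
    then have "takes_on n (n - 1) (circuit_eval h) v"
      using takes_on_affine[OF affine] by blast
    then show ?thesis
      using m by (intro takes) (auto elim: takes_on_mono)
  next
    case False
    have "circuit_eval h x = 1 + v" if "x \<in> F2_space n" for x
      using False that by (cases v; cases "circuit_eval h x") auto
    then show ?thesis by (rule avoids)
  qed
next
  case (cube u P N)
  have fin: "finite P" "finite N"
    using cube(2,3) by (auto intro: finite_subset[OF _ finite_lessThan])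
  show ?thesis
  proof (cases "u = v")
    case True
    \<comment> \<open>Here \<open>h\<close> equals \<open>v\<close> once the conjunction is
      falsified, and fixing a single literal does this at the cost of one dimension.\<close>
    have vanish: "takes_on n K (circuit_eval h) v"
      if l: "l < n" and zero: "\<And>x. x l = w \<Longrightarrow> cube P N x = 0" for l w
    proof -
      obtain A where "affine_subspace n (n - 1) A" "\<forall>x\<in>A. x l = w"
        using takes_on_coord[OF l, of w] unfolding takes_on_def by blast
      then have "takes_on n (n - 1) (circuit_eval h) v"
        unfolding takes_on_def using zero True cube(4) by auto
      then show ?thesis
        using m by (auto elim: takes_on_mono)
    qed
    consider "P = {}" "N = {}" | l where "l \<in> P" | l where "l \<in> N"
      by blast
    then show ?thesis
    proof cases
      case 1
      then show ?thesis
        using True cube(4) by (intro avoids) (simp add: cube_def add.commute)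
    next
      case 2
      then show ?thesis
        using cube(2) by (intro takes vanish[of l 0]) (auto intro!: cube_eq_0 fin)
    next
      case 3
      then show ?thesis
        using cube(3) by (intro takes vanish[of l 1]) (auto intro!: cube_eq_0 fin)
    qed
  next
    case False
    then have u: "u = 1 + v"
      by (cases u; cases v) auto
    show ?thesis
    proof (cases "P \<inter> N = {}")
      case True
      show ?thesis
      proof (cases "n - m < card (P \<union> N)")
        case True
        then show ?thesis
          using wide[of P N] cube u by blast
      next
        case False
        then have "takes_on n K (cube P N) 1"
          using takes_on_cube[OF cube(2,3) True] m by (auto elim: takes_on_mono)
        then show ?thesis
          using cube(4) u by (intro takes) (auto simp: takes_on_def add.commute)
      qed
    next
      case False
      then obtain l where l: "l \<in> P" "l \<in> N" by blast
      have "cube P N x = 0" for x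
        using l by (cases "x l = 0") (auto intro!: cube_eq_0 fin)
      then show ?thesis
        using cube(4) u by (intro avoids) simp
    qed
  qed
qed

section \<open>Circuits by the kind of their top gate\<close>

lemma finite_circuit_gates: "finite (circuit_gates C)"
  by (induction C) auto

lemma card_gate_children:
  "card {h \<in> set cs. \<exists>g ds. h = Gate g ds} \<le> circuit_size (Gate g' cs)"
proof -
  have "h \<in> circuit_gates h" if "\<exists>g ds. h = Gate g ds" for h
    using that by auto
  then have "{h \<in> set cs. \<exists>g ds. h = Gate g ds} \<subseteq> circuit_gates (Gate g' cs)"
    by auto
  then show ?thesis
    unfolding circuit_size_def by (intro card_mono finite_circuit_gates)
qed

lemma takes_on_xor_gate:
  assumes d: "circuit_depth (Gate XOR cs) \<le> 2" and vars: "circuit_vars (Gate XOR cs) \<subseteq> {..<n}"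
    and b: "2 \<le> b" "(m + 1) * b \<le> n" and size: "real (circuit_size (Gate XOR cs)) < (real b / 2) ^ Suc D"
  shows "\<exists>v. takes_on n (k2 m D) (circuit_eval (Gate XOR cs)) v"
proof -
  \<comment> \<open>Affine children stay affine under every restriction, so only the others have to
    be controlled; repeated children enter once.\<close>
  define G where "G = {h \<in> set cs. \<not> lowdeg {..<n} 1 (circuit_eval h)}"
  have ex: "(\<exists>g ds. h = Gate g ds) \<and> (\<exists>w. fst (snd w) \<subseteq> {..<n} \<and> snd (snd w) \<subseteq> {..<n} \<and>
      (\<forall>x. circuit_eval h x = fst w + cube (fst (snd w)) (snd (snd w)) x))"
    if "h \<in> G" for h
  proof -
    have "circuit_depth h \<le> 1" "circuit_vars h \<subseteq> {..<n}"
      using circuit_depth_child[of XOR cs 1 h] d vars that by (auto simp: G_def)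
    then show ?thesis
      using finite_lessThan
    proof (cases rule: depth_le_1_cases)
      case affine
      then show ?thesis using that by (simp add: G_def)
    next
      case (cube u P N)
      then show ?thesis by (intro conjI exI[of _ "(u, P, N)"]) auto
    qed
  qed
  then have "\<forall>h\<in>G. \<exists>w. fst (snd w) \<subseteq> {..<n} \<and> snd (snd w) \<subseteq> {..<n} \<and>
      (\<forall>x. circuit_eval h x = fst w + cube (fst (snd w)) (snd (snd w)) x)"
    by blast
  from bchoice[OF this] obtain w where w: "\<forall>h\<in>G. fst (snd (w h)) \<subseteq> {..<n} \<and> snd (snd (w h)) \<subseteq> {..<n} \<and>
      (\<forall>x. circuit_eval h x = fst (w h) + cube (fst (snd (w h))) (snd (snd (w h))) x)"
    by blast
  define U P N where "U h = fst (w h)" and "P h = fst (snd (w h))" and "N h = snd (snd (w h))" for h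
  have UPN: "P h \<subseteq> {..<n}" "N h \<subseteq> {..<n}" "circuit_eval h x = U h + cube (P h) (N h) x" if "h \<in> G" for h x
    using w that by (simp_all add: U_def P_def N_def)
  have "card G \<le> card {h \<in> set cs. \<exists>g ds. h = Gate g ds}"
    using ex by (intro card_mono) (auto simp: G_def)
  also have "\<dots> \<le> circuit_size (Gate XOR cs)"
    by (rule card_gate_children)
  finally have cardG: "real (card G) < (real b / 2) ^ Suc D"
    using size by linarith
  have finG: "finite G"
    by (simp add: G_def)
  \<comment> \<open>For \<open>D = 0\<close> the bottom layer still contributes affine functions, whose level sets lose one dimension.\<close>
  define M where "M = (if D = 0 then m + 1 else m)"
  have Mb: "M * b \<le> n"
    using b(2) by (auto simp: M_def)
  obtain s j where sj: "s \<in> F2_space n" "inj_on j {..<M}" "j ` {..<M} \<subseteq> {..<n}"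
    and low: "\<And>h. h \<in> G \<Longrightarrow> lowdeg {..<M} D (\<lambda>y. cube (P h) (N h) (s + embed j M y))"
    using exists_restriction[OF b(1) Mb finG cardG, of P N] UPN(1,2) by blast
  let ?f = "\<lambda>y. circuit_eval (Gate XOR cs) (s + embed j M y)"
  have "lowdeg {..<M} (max D 1) (\<lambda>y. circuit_eval h (s + embed j M y))" if "h \<in> set cs" for h
  proof (cases "h \<in> G")
    case True
    then have "lowdeg {..<M} D (\<lambda>y. U h + cube (P h) (N h) (s + embed j M y))"
      by (intro lowdeg_add lowdeg_const low)
    then show ?thesis
      using UPN(3)[OF True] by (auto elim: lowdeg_mono)
  next
    case False
    then have "lowdeg {..<n} 1 (circuit_eval h)"
      using that by (simp add: G_def)
    then have "lowdeg {..<M} 1 (\<lambda>y. circuit_eval h (s + embed j M y))"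
      by (rule lowdeg_embed[OF sj(2)])
    then show ?thesis
      by (rule lowdeg_mono) auto
  qed
  then have "lowdeg {..<M} (max D 1) (\<lambda>y. \<Sum>h\<leftarrow>cs. circuit_eval h (s + embed j M y))"
    by (rule lowdeg_sum_list)
  then have f: "lowdeg {..<M} (max D 1) ?f"
    by (simp add: o_def)
  have "\<exists>v. takes_on M (k2 m D) ?f v"
  proof (cases "D = 0")
    case True
    then have "lowdeg {..<M} 1 ?f"
      using f by simp
    then have "takes_on M (M - 1) ?f (?f 0)"
      by (rule takes_on_affine) (auto simp: F2_space_0)
    moreover have "k2 m D \<le> M - 1"
      using True k2_admissible_le[OF k2_admissible_k2, of m D] by (simp add: M_def)
    ultimately show ?thesis
      using takes_on_mono by blast
  next
    case False
    then have "M = m" "max D 1 = D"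
      by (auto simp: M_def)
    then show ?thesis
      using f takes_on_k2[of m D ?f] by metis
  qed
  then show ?thesis
    using takes_on_embed[OF _ sj] by blast
qed

text \<open>A child equal to \<open>v\<close> on a large subspace decides the gate there. Otherwise
  every child that attains \<open>v\<close> at all is wide, and falsifying these conjunctions
  together gives the value \<open>1 + v\<close>.\<close>

lemma takes_on_and_or_gate:
  fixes v :: bit
  assumes g: "g = AND \<and> v = 0 \<or> g = OR \<and> v = 1"
    and d: "circuit_depth (Gate g cs) \<le> 2" and vars: "circuit_vars (Gate g cs) \<subseteq> {..<n}"
    and m: "2 * m \<le> n" "m < n" "K \<le> m" and size: "circuit_size (Gate g cs) < 2 ^ (n - 2 * m)"
  shows "\<exists>v. takes_on n K (circuit_eval (Gate g cs)) v"
proof (cases "\<exists>h\<in>set cs. takes_on n K (circuit_eval h) v")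
  case True
  then obtain h A where h: "h \<in> set cs" and A: "affine_subspace n K A" "\<forall>x\<in>A. circuit_eval h x = v"
    unfolding takes_on_def by blast
  have "circuit_eval (Gate g cs) x = v" if "x \<in> A" for x
    using g h bspec[OF A(2) that] by auto
  then show ?thesis
    unfolding takes_on_def using A(1) by blast
next
  case none: False
  define G where "G = {h \<in> set cs. \<exists>x\<in>F2_space n. circuit_eval h x \<noteq> 1 + v}"
  have ex: "\<exists>P N. (\<exists>g ds. h = Gate g ds) \<and> P \<subseteq> {..<n} \<and> N \<subseteq> {..<n} \<and> n - m < card (P \<union> N) \<and>
      (\<forall>x. circuit_eval h x = 1 + v + cube P N x)"
    if "h \<in> G" for h
  proof -
    have "circuit_depth h \<le> 1" "circuit_vars h \<subseteq> {..<n}"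
      using circuit_depth_child[of g cs 1 h] d vars that by (auto simp: G_def)
    then show ?thesis
      using m(2,3)
    proof (cases rule: depth_le_1_takes_on[where v = v])
      case takes
      then show ?thesis using that none by (simp add: G_def)
    next
      case avoids
      then show ?thesis using that by (auto simp: G_def)
    next
      case (wide P N)
      then show ?thesis by blast
    qed
  qed
  then obtain P N where PN: "\<And>h. h \<in> G \<Longrightarrow> P h \<subseteq> {..<n}" "\<And>h. h \<in> G \<Longrightarrow> N h \<subseteq> {..<n}"
      "\<And>h. h \<in> G \<Longrightarrow> n - m < card (P h \<union> N h)"
    and eval: "\<And>h x. h \<in> G \<Longrightarrow> circuit_eval h x = 1 + v + cube (P h) (N h) x"
    by metis
  have "card G \<le> card {h \<in> set cs. \<exists>g ds. h = Gate g ds}"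
    using ex by (intro card_mono) (auto simp: G_def)
  also have "\<dots> \<le> circuit_size (Gate g cs)"
    by (rule card_gate_children)
  finally have cardG: "card G < 2 ^ (n - 2 * m)"
    using size by linarith
  have "finite G"
    by (simp add: G_def)
  from avoid_wide_cubes[OF this cardG m(1), of P N] PN
  have "\<exists>A. affine_subspace n m A \<and> (\<forall>x\<in>A. \<forall>h\<in>G. cube (P h) (N h) x = 0)"
    by simp
  then obtain A where A: "affine_subspace n m A" "\<And>x h. x \<in> A \<Longrightarrow> h \<in> G \<Longrightarrow> cube (P h) (N h) x = 0"
    by blast
  have "circuit_eval h x = 1 + v" if "h \<in> set cs" "x \<in> A" for h x
  proof (cases "h \<in> G")
    case True
    then show ?thesis using A(2) eval that by simp
  next
    case False
    then show ?thesis
      using that affine_subspace_subset[OF A(1)] by (auto simp: G_def)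
  qed
  then have "\<forall>x\<in>A. circuit_eval (Gate g cs) x = 1 + v"
    using g by auto
  then have "takes_on n m (circuit_eval (Gate g cs)) (1 + v)"
    unfolding takes_on_def using A(1) by blast
  then show ?thesis
    using m(3) takes_on_mono by blast
qed

section \<open>Numerical estimates\<close>

text \<open>The \<open>m + 1\<close> blocks include a spare one for degree 0. From m + 1 <= 2 * sqrt
  n / 5 the block length exceeds 2 * sqrt n, while n^c = (sqrt n)^(2c) is at most (sqrt
  n)^(D+1).\<close>

lemma size_bounds:
  fixes c :: real and n m D S :: nat
  assumes "c > 0" and m: "m = nat \<lfloor>sqrt (real n) / 5\<rfloor>" "1 \<le> m" and D: "D = nat \<lfloor>2 * c\<rfloor>"
    and S: "real S \<le> real n powr c"
  shows "25 * m ^ 2 \<le> n"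
    and "2 \<le> n div (m + 1)" and "real S < (real (n div (m + 1)) / 2) ^ Suc D"
    and "D < m \<Longrightarrow> S < 2 ^ (n - 2 * m)"
proof -
  let ?r = "sqrt (real n)"
  have "real m \<le> ?r / 5"
    using m by linarith
  then have r: "5 * real m \<le> ?r" "5 \<le> ?r"
    using m(2) by auto
  have rr: "?r * ?r = real n"
    by simp
  have "(5 * real m) ^ 2 \<le> ?r ^ 2"
    using r by (intro power_mono) auto
  then have "real (25 * m ^ 2) \<le> real n"
    by (simp add: power_mult_distrib)
  then show "25 * m ^ 2 \<le> n"
    by (simp only: of_nat_le_iff)
  define b where "b = n div (m + 1)"
  have "real n < (real b + 1) * (real m + 1)"
  proof -
    have "n < (b + 1) * (m + 1)"
      unfolding b_def using dividend_less_div_times[of "m + 1" n] by (simp add: algebra_simps)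
    then have "real n < real ((b + 1) * (m + 1))"
      by (simp only: of_nat_less_iff)
    then show ?thesis by (simp add: algebra_simps)
  qed
  also have "\<dots> \<le> (real b + 1) * (2 * ?r / 5)"
    using r by (intro mult_left_mono) auto
  finally have "5 * real n < ?r * (2 * (real b + 1))"
    by (simp add: algebra_simps)
  moreover have "?r * (5 * ?r) = 5 * real n"
    unfolding mult.left_commute[of ?r 5] rr ..
  ultimately have "?r * (5 * ?r) < ?r * (2 * (real b + 1))"
    by (simp only:)
  then have "5 * ?r < 2 * (real b + 1)"
    by (rule mult_left_less_imp_less) simp
  then have b: "?r < real b / 2"
    using r by simp
  then show "2 \<le> n div (m + 1)"
    using r unfolding b_def[symmetric] by linarith
  have "2 * c \<le> real (Suc D)"
    using D \<open>c > 0\<close> by linarith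
  have "?r powr 2 = real n"
    using r by (simp add: powr_half_sqrt[symmetric] powr_powr)
  then have "real n powr c = ?r powr (2 * c)"
    using powr_powr[of ?r 2 c] by (simp only:)
  also have "\<dots> \<le> ?r powr real (Suc D)"
    using r \<open>2 * c \<le> _\<close> by (intro powr_mono) linarith+
  also have "\<dots> = ?r ^ Suc D"
    using r by (intro powr_realpow) linarith
  finally have Sr: "real S \<le> ?r ^ Suc D"
    using S by linarith
  also have "?r ^ Suc D < (real b / 2) ^ Suc D"
    using b r by (intro power_strict_mono) auto
  finally show "real S < (real (n div (m + 1)) / 2) ^ Suc D"
    unfolding b_def .
  show "S < 2 ^ (n - 2 * m)" if "D < m"
  proof -
    \<comment> \<open>Since \<open>?r < 2 ^ q\<close>, the size is below \<open>2 ^ (q * m)\<close>;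
      and \<open>(q + 2) * m \<le> n\<close> because ?r + 3 <= 5 * ?r.\<close>
    define q where "q = nat \<lceil>?r\<rceil>"
    have q: "?r \<le> real q" "real q < ?r + 1"
      using r unfolding q_def by linarith+
    have "real ((q + 2) * m) \<le> (?r + 3) * (?r / 5)"
      using q r unfolding of_nat_mult by (intro mult_mono) auto
    also have "\<dots> \<le> ?r * ?r"
      using mult_right_mono[of "?r + 3" "5 * ?r" "?r / 5"] r by simp
    finally have "real ((q + 2) * m) \<le> real n"
      using rr by simp
    then have "(q + 2) * m \<le> n"
      by (simp only: of_nat_le_iff)
    then have qm: "q * m \<le> n - 2 * m"
      by (simp add: algebra_simps)
    have "real S \<le> ?r ^ m"
      using Sr power_increasing[of "Suc D" m ?r] that r by linarith
    also have "\<dots> < (2 ^ q) ^ m"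
    proof (intro power_strict_mono)
      show "?r < 2 ^ q"
        using q(1) of_nat_less_two_power[of q, where ?'a = real] by linarith
    qed (use m r in auto)
    also have "\<dots> = 2 ^ (q * m)"
      by (simp add: power_mult)
    also have "\<dots> \<le> 2 ^ (n - 2 * m)"
      using qm by (intro power_increasing) auto
    finally have "real S < real (2 ^ (n - 2 * m))"
      by simp
    then show ?thesis
      by (simp only: of_nat_less_iff)
  qed
qed

text \<open>For \<open>m \<le> D\<close>, in particular for \<open>m = 0\<close>, no circuit
  structure is used. Otherwise the kind of the top gate decides which restriction argument
  applies.\<close>

lemma small_depth_2_circuit_takes_on:
  fixes c :: real
  assumes "c > 0" and d: "circuit_depth C \<le> 2" and size: "real (circuit_size C) \<le> real n powr c"
    and vars: "circuit_vars C \<subseteq> {..<n}"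
  shows "\<exists>v. takes_on n (k2 (nat \<lfloor>sqrt (real n) / 5\<rfloor>) (nat \<lfloor>2 * c\<rfloor>)) (circuit_eval C) v"
proof -
  define m where "m = nat \<lfloor>sqrt (real n) / 5\<rfloor>"
  define D where "D = nat \<lfloor>2 * c\<rfloor>"
  have "\<exists>v. takes_on n (k2 m D) (circuit_eval C) v"
  proof (cases "m = 0")
    case True
    then show ?thesis
      by (intro takes_on_k2_large_degree) auto
  next
    case False
    then have "1 \<le> m" by simp
    note bounds = size_bounds[OF assms(1) m_def this D_def size]
    have "m * 25 \<le> 25 * m ^ 2"
      using \<open>1 \<le> m\<close> by (simp add: power2_eq_square)
    then have mn: "m * 25 \<le> n"
      using bounds(1) by linarith
    have K: "k2 m D \<le> m"
      by (rule k2_admissible_le[OF k2_admissible_k2])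
    have literal: ?thesis if "circuit_depth C \<le> 0"
    proof -
      have "takes_on n (n - 1) (circuit_eval C) (circuit_eval C 0)"
        using takes_on_affine[OF lowdeg_literal[OF that vars] F2_space_0] by blast
      moreover have "k2 m D \<le> n - 1"
        using K mn False by linarith
      ultimately show ?thesis
        using takes_on_mono by blast
    qed
    show ?thesis
    proof (cases "m \<le> D")
      case True
      then show ?thesis
        using mn by (intro takes_on_k2_large_degree) auto
    next
      case False
      have and_or: ?thesis if "C = Gate g cs" "g = AND \<and> v = 0 \<or> g = OR \<and> v = 1" for g cs and v :: bit
        using takes_on_and_or_gate[OF that(2), of cs n m "k2 m D"] that(1) d vars mn K \<open>m \<noteq> 0\<close> bounds(4) False
        by simp
      show ?thesis
      proof (cases C)
        case (Gate g cs)
        show ?thesis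
        proof (cases g)
          case XOR
          have "(m + 1) * (n div (m + 1)) \<le> n"
            by (rule times_div_less_eq_dividend)
          then show ?thesis
            using takes_on_xor_gate[of cs n _ m D, OF _ _ bounds(2)] d vars bounds(3) Gate XOR by blast
        qed (use and_or Gate in auto)
      qed (use literal in auto)
    qed
  qed
  then show ?thesis
    by (simp only: m_def D_def)
qed

section \<open>Growth of \<open>k2\<close>\<close>

lemma k2_lower_bound:
  assumes "1 \<le> D" "D + 1 \<le> m"
  shows "(real m / real (D + 1)) powr (1 / real D) \<le> 2 * real (k2 m D)"
proof -
  let ?X = "(real m / real (D + 1)) powr (1 / real D)"
  have X: "1 \<le> ?X"
    using assms by (intro ge_one_powr_ge_zero) auto
  define k where "k = nat \<lfloor>?X\<rfloor>"
  have k: "real k \<le> ?X" "?X < real k + 1"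
    using X unfolding k_def by linarith+
  have "real k ^ D \<le> ?X ^ D"
    using k by (intro power_mono) auto
  also have "\<dots> = real m / real (D + 1)"
    using assms by (simp add: powr_realpow[symmetric] powr_powr)
  finally have "real ((D + 1) * k ^ D) \<le> real m"
    by (simp add: field_simps)
  then have "(D + 1) * k ^ D \<le> m"
    by (simp only: of_nat_le_iff)
  then have "k \<le> k2 m D"
    by (intro k2_ge k2_admissible_of_power_le assms)
  \<comment> \<open>The factor 2 absorbs the rounding: k + 1 <= 2 * k for k >= 1.\<close>
  moreover have "1 \<le> real k"
    using X k(2) by (cases k) auto
  ultimately show ?thesis
    using k by linarith
qed

text \<open>The assumption on \<open>c\<close> makes the degree at least 1. Below 1/2 the claim
  fails: \<open>k2\<close> is at most sqrt n / 5, while the exponent 1 / (4c) exceeds 1/2.\<close>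

lemma k2_bigomega:
  fixes c :: real
  assumes "c \<ge> 1 / 2"
  shows "(\<lambda>n. real (k2 (nat \<lfloor>sqrt (real n) / 5\<rfloor>) (nat \<lfloor>2 * c\<rfloor>))) \<in> \<Omega>(\<lambda>n. real n powr (1 / (4 * c)))"
proof -
  define D where "D = nat \<lfloor>2 * c\<rfloor>"
  have D: "1 \<le> D" "real D \<le> 2 * c"
    using assms unfolding D_def by linarith+
  \<comment> \<open>The 10 comes from m >= sqrt n / 10, the 2 from
    \<open>k2_lower_bound\<close>.\<close>
  define B where "B = (1 / (10 * real (D + 1))) powr (1 / real D) / 2"
  have "B > 0"
    by (simp add: B_def)
  moreover have "eventually (\<lambda>n. norm (real (k2 (nat \<lfloor>sqrt (real n) / 5\<rfloor>) D)) \<ge> B * norm (real n powr (1 / (4 * c)))) at_top"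
  proof (rule eventually_at_top_linorderI)
    \<comment> \<open>Beyond this threshold sqrt n / 10 is at least \<open>D + 1\<close>, and
      rounding down in \<open>m\<close> loses at most half.\<close>
    fix n assume n: "(10 * (D + 1)) ^ 2 \<le> n"
    define m where "m = nat \<lfloor>sqrt (real n) / 5\<rfloor>"
    have "sqrt (real ((10 * (D + 1)) ^ 2)) \<le> sqrt (real n)"
      using n by (intro real_sqrt_le_mono) (simp only: of_nat_le_iff)
    then have r: "10 * real (D + 1) \<le> sqrt (real n)"
      by simp
    moreover have "20 \<le> 10 * real (D + 1)"
      using D(1) by simp
    then have "20 \<le> sqrt (real n)"
      using r by (rule order_trans)
    moreover have "sqrt (real n) / 5 < real m + 1"
      unfolding m_def by linarith
    ultimately have m1: "sqrt (real n) / 10 \<le> real m"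
      by linarith
    moreover have "real (D + 1) \<le> sqrt (real n) / 10"
      using r by simp
    ultimately have m2: "real (D + 1) \<le> real m"
      by linarith
    have n1: "1 \<le> real n"
      using n by (cases n) auto
    have "real n powr (1 / (4 * c)) \<le> real n powr (1 / (2 * real D))"
      using D n1 by (intro powr_mono) (auto simp: field_simps)
    also have "\<dots> = sqrt (real n) powr (1 / real D)"
      using n1 by (simp add: powr_half_sqrt[symmetric] powr_powr)
    finally have "B * real n powr (1 / (4 * c)) \<le> B * sqrt (real n) powr (1 / real D)"
      using \<open>B > 0\<close> by simp
    also have "\<dots> = (sqrt (real n) / 10 / real (D + 1)) powr (1 / real D) / 2"
      unfolding B_def by (simp add: powr_mult[symmetric] mult.commute)
    also have "\<dots> \<le> (real m / real (D + 1)) powr (1 / real D) / 2"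
      using m1 by (intro divide_right_mono powr_mono2) auto
    also have "\<dots> \<le> real (k2 m D)"
    proof -
      have "D + 1 \<le> m"
        using m2 by (simp only: of_nat_le_iff)
      then show ?thesis
        using k2_lower_bound[OF D(1)] by (simp add: mult.commute)
    qed
    finally show "norm (real (k2 (nat \<lfloor>sqrt (real n) / 5\<rfloor>) D)) \<ge> B * norm (real n powr (1 / (4 * c)))"
      by (simp add: m_def)
  qed
  ultimately show ?thesis
    unfolding D_def by (rule landau_omega.bigI)
qed

theorem theorem8:
  fixes c :: real
  assumes "c > 0"
  shows "(\<forall>n k C f.
            circuit_depth C \<le> 2 \<and> real (circuit_size C) \<le> real n powr c \<and>
            computes n C f \<and> affine_disperser n k f \<longrightarrow>
            k > k2 (nat \<lfloor>sqrt (real n) / 5\<rfloor>) (nat \<lfloor>2 * c\<rfloor>)) \<and>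
         (c \<ge> 1 / 2 \<longrightarrow>
            (\<lambda>n::nat. real (k2 (nat \<lfloor>sqrt (real n) / 5\<rfloor>) (nat \<lfloor>2 * c\<rfloor>)))
              \<in> \<Omega>(\<lambda>n. real n powr (1 / (4 * c))))"
proof (intro conjI allI impI k2_bigomega)
  fix n k C f
  assume asm: "circuit_depth C \<le> 2 \<and> real (circuit_size C) \<le> real n powr c \<and>
    computes n C f \<and> affine_disperser n k f"
  show "k > k2 (nat \<lfloor>sqrt (real n) / 5\<rfloor>) (nat \<lfloor>2 * c\<rfloor>)"
  proof (rule ccontr)
    assume "\<not> ?thesis"
    moreover obtain v where "takes_on n (k2 (nat \<lfloor>sqrt (real n) / 5\<rfloor>) (nat \<lfloor>2 * c\<rfloor>)) (circuit_eval C) v"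
      using small_depth_2_circuit_takes_on[OF assms, of C n] asm by (auto simp: computes_def)
    \<comment> \<open>The subspace is shrunk to dimension exactly \<open>k\<close>, as dispersers
      are tested in one dimension only.\<close>
    ultimately have "takes_on n k (circuit_eval C) v"
      by (auto elim: takes_on_mono)
    then obtain A where A: "affine_subspace n k A" "\<forall>x\<in>A. circuit_eval C x = v"
      unfolding takes_on_def by blast
    then have "\<forall>x\<in>A. f x = v"
      using asm affine_subspace_subset[OF A(1)] by (metis computes_def subsetD)
    then have "f constant_on A"
      unfolding constant_on_def by blast
    then show False
      using asm A(1) unfolding affine_disperser_def by blast
  qed
qed

end
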